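(* Let $K\subset\mathbb R^n$ be a Cantor set, $n\geqslant2$. For each $\varepsilon>0$ there exists an $\varepsilon$-isotopy $\{h_t\}$ of $\mathbb R^n$ such that $\dim p_\Pi(h_1(K))=\dim\Pi$ for each plane $\Pi\subsetneqq\mathbb R^n$.
   Context: A Cantor set is any topological space homeomorphic to the standard middle-thirds Cantor set. A plane in $\mathbb R^n$ is an affine subspace (of any dimension); $p_\Pi:\mathbb R^n\to\Pi$ is the orthogonal projection onto $\Pi$. $\dim$ is topological (covering) dimension. With $I=[0,1]$, an isotopy of $\mathbb R^n$ is a level-preserving homeomorphism $H:\mathbb R^n\times I\to\mathbb R^n\times I$, $H(x,t)=(h_t(x),t)$, with $h_0=\mathrm{id}$; it is written $\{h_t\}$. It is an $\varepsilon$-isotopy if $d(h_t(x),x)\leqslant\varepsilon$ for each $x\in\mathbb R^n$ and each $t\in I$, where $d$ is the Euclidean distance. *)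

theory Defs
  imports "HOL-Analysis.Analysis"
begin

primrec middle_thirds_stage :: "nat \<Rightarrow> real set" where
  "middle_thirds_stage 0 = {0..1}"
| "middle_thirds_stage (Suc n) =
     (\<lambda>x. x / 3) ` middle_thirds_stage n \<union> (\<lambda>x. 2 / 3 + x / 3) ` middle_thirds_stage n"

definition standard_cantor_set :: "real set" where
  "standard_cantor_set = (\<Inter>n. middle_thirds_stage n)"

definition is_cantor_set :: "'a::topological_space set \<Rightarrow> bool" where
  "is_cantor_set K \<longleftrightarrow> K homeomorphic standard_cantor_set"

definition open_cover :: "'a topology \<Rightarrow> 'a set set \<Rightarrow> bool" where
  "open_cover X \<U> \<longleftrightarrow> (\<forall>U\<in>\<U>. openin X U) \<and> \<Union>\<U> = topspace X"

text \<open>Every finite open cover has a finite open refinement of order at most \<open>m\<close>,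
  i.e. one in which every point lies in at most \<open>m + 1\<close> members.  The bound \<open>m\<close> ranges
  over the integers \<open>\<ge> -1\<close>; the value \<open>-1\<close> is attained by the empty space only.\<close>

definition covering_dim_le :: "'a topology \<Rightarrow> int \<Rightarrow> bool" where
  "covering_dim_le X m \<longleftrightarrow> -1 \<le> m \<and>
     (\<forall>\<U>. finite \<U> \<and> open_cover X \<U> \<longrightarrow>
       (\<exists>\<V>. finite \<V> \<and> open_cover X \<V> \<and> (\<forall>V\<in>\<V>. \<exists>U\<in>\<U>. V \<subseteq> U) \<and>
            (\<forall>x\<in>topspace X. int (card {V \<in> \<V>. x \<in> V}) \<le> m + 1)))"

text \<open>The value is \<open>\<infinity>\<close> if no bound exists (infimum of the empty set).\<close>

definition covering_dim :: "'a topology \<Rightarrow> ereal" where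
  "covering_dim X = (INF m\<in>{m. covering_dim_le X m}. ereal (of_int m))"

text \<open>The empty set is \<open>affine\<close> in the library, but it is not a plane.\<close>

definition plane :: "'a::real_vector set \<Rightarrow> bool" where
  "plane P \<longleftrightarrow> affine P \<and> P \<noteq> {}"

definition orthogonal_projection :: "'a::euclidean_space set \<Rightarrow> 'a \<Rightarrow> 'a" where
  "orthogonal_projection P x = (THE y. y \<in> P \<and> (\<forall>z\<in>P. orthogonal (x - y) (z - y)))"

lemma orthogonal_projection_exists_unique:
  fixes P :: "'a::euclidean_space set"
  assumes "plane P"
  shows "\<exists>!y. y \<in> P \<and> (\<forall>z\<in>P. orthogonal (x - y) (z - y))"
proof -
  from assms obtain a where a: "a \<in> P" and aff: "affine P"
    by (auto simp: plane_def)
  let ?S = "(+) (- a) ` P"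
  have sub: "subspace ?S"
    using affine_diffs_subspace [OF aff a] by simp
  obtain u v where u: "u \<in> span ?S" and v: "\<And>w. w \<in> span ?S \<Longrightarrow> orthogonal v w"
    and x: "x - a = u + v"
    using orthogonal_subspace_decomp_exists by metis
  have uS: "u \<in> ?S" and vS: "\<And>w. w \<in> ?S \<Longrightarrow> orthogonal v w"
    using u v span_eq_iff [THEN iffD2, OF sub] by metis+
  have "a + u \<in> P"
    using uS by auto
  moreover have "orthogonal (x - (a + u)) (z - (a + u))" if "z \<in> P" for z
  proof -
    have "z - a \<in> ?S"
      using that by auto
    then have "(z - a) - u \<in> ?S"
      using uS sub subspace_diff by blast
    moreover have "x - (a + u) = v" "z - (a + u) = (z - a) - u"
      using x by (simp_all add: algebra_simps)
    ultimately show ?thesis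
      using vS by metis
  qed
  moreover have "y = y'"
    if "y \<in> P" "\<forall>z\<in>P. orthogonal (x - y) (z - y)" "y' \<in> P" "\<forall>z\<in>P. orthogonal (x - y') (z - y')"
    for y y'
  proof -
    have "(x - y) \<bullet> (y' - y) = 0" "(x - y') \<bullet> (y - y') = 0"
      using that by (auto simp: orthogonal_def)
    then have "(y' - y) \<bullet> (y' - y) = 0"
      by (simp add: inner_diff_left inner_diff_right inner_commute)
    then show ?thesis
      by simp
  qed
  ultimately show ?thesis
    by blast
qed

text \<open>The family \<open>h\<close> stands for the level-preserving map \<open>H (x, t) = (h t x, t)\<close>; the values
  \<open>h t\<close> for \<open>t\<close> outside the unit interval are irrelevant.\<close>

definition isotopy :: "(real \<Rightarrow> 'a::topological_space \<Rightarrow> 'a) \<Rightarrow> bool" where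
  "isotopy h \<longleftrightarrow>
     (\<exists>G. homeomorphism (UNIV \<times> {0..1}) (UNIV \<times> {0..1}) (\<lambda>(x, t). (h t x, t)) G) \<and> h 0 = id"

definition eps_isotopy :: "real \<Rightarrow> (real \<Rightarrow> 'a::metric_space \<Rightarrow> 'a) \<Rightarrow> bool" where
  "eps_isotopy \<epsilon> h \<longleftrightarrow> isotopy h \<and> (\<forall>x. \<forall>t\<in>{0..1}. dist (h t x) x \<le> \<epsilon>)"

end

theory Submission
  imports Defs
begin

text \<open>
  It suffices to find a homeomorphism \<open>h\<close> moving points by at most \<open>\<epsilon>\<close> such that, for every
  direction \<open>v\<close>, a nonempty open family of lines parallel to \<open>v\<close> meets \<open>h(K)\<close>: the Alexander trick
  makes \<open>h\<close> an isotopy, and the projection of \<open>h(K)\<close> to a proper plane, which factors through the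
  projection along a normal \<open>v\<close>, then contains a ball of the plane. A compact subset of a plane
  containing a ball has the dimension of the plane, because the plane is a union of two families of
  disjoint annuli, each of which is similar to a subset of that ball.

  The homeomorphism \<open>h\<close> is the inverse of a limit of homeomorphisms. Near each of finitely many
  points of \<open>K\<close>, one for each coordinate direction, take nested families of disjoint flat cells such
  that every line that is not too oblique to the coordinate direction and crosses the core of a cell
  also crosses the core of one of its children; such lines meet the intersection \<open>X\<close> of the families.
  Within a cell, the children can be shrunk and moved close to points of \<open>K\<close>, since \<open>K\<close> has no
  isolated points; in the limit \<open>X\<close> is carried into \<open>K\<close>.
\<close>

section \<open>Covering dimension of plane regions\<close>

text \<open>Covers are indexed families rather than sets of sets, so that the order bound survives when two
  rounds of shrinking are composed.\<close>

definition shrinkable :: "'a::topological_space set \<Rightarrow> int \<Rightarrow> bool" where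
  "shrinkable S m \<longleftrightarrow> (\<forall>(I :: 'a set set) U. finite I \<and> (\<forall>i\<in>I. open (U i)) \<and> S \<subseteq> (\<Union>i\<in>I. U i) \<longrightarrow>
     (\<exists>V. (\<forall>i\<in>I. open (V i) \<and> V i \<subseteq> U i) \<and> S \<subseteq> (\<Union>i\<in>I. V i) \<and>
          (\<forall>x\<in>S. int (card {i\<in>I. x \<in> V i}) \<le> m + 1)))"

lemma shrinkableD:
  fixes S :: "'a::topological_space set" and I :: "'a set set"
  assumes "shrinkable S m" "finite I" "\<And>i. i \<in> I \<Longrightarrow> open (U i)" "S \<subseteq> (\<Union>i\<in>I. U i)"
  shows "\<exists>V. (\<forall>i\<in>I. open (V i) \<and> V i \<subseteq> U i) \<and> S \<subseteq> (\<Union>i\<in>I. V i) \<and>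
          (\<forall>x\<in>S. int (card {i\<in>I. x \<in> V i}) \<le> m + 1)"
  using assms(1) [unfolded shrinkable_def, rule_format, of I U] assms(2-4) by simp

text \<open>A refinement becomes a shrinking by merging all members assigned to one index: the
  members through a point map onto the indices through it, so the order does not grow. Conversely a
  cover indexes itself, which is why indices have type \<open>'a set\<close>. The order is counted
  at points of \<open>S\<close> only, so sets open in the whole space can replace relatively open
  ones.\<close>

lemma covering_dim_le_iff_shrinkable:
  fixes S :: "'a::topological_space set"
  shows "covering_dim_le (top_of_set S) m \<longleftrightarrow> -1 \<le> m \<and> shrinkable S m"
proof
  assume L: "covering_dim_le (top_of_set S) m"
  have "\<exists>V. (\<forall>i\<in>I. open (V i) \<and> V i \<subseteq> U i) \<and> S \<subseteq> (\<Union>i\<in>I. V i) \<and>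
          (\<forall>x\<in>S. int (card {i\<in>I. x \<in> V i}) \<le> m + 1)"
    if fin: "finite I" and op: "\<forall>i\<in>I. open (U i)" and cov: "S \<subseteq> (\<Union>i\<in>I. U i)"
    for I :: "'a set set" and U
  proof -
    have "open_cover (top_of_set S) ((\<lambda>i. S \<inter> U i) ` I)"
      using op cov by (auto simp: open_cover_def openin_open)
    moreover have "finite ((\<lambda>i. S \<inter> U i) ` I)"
      using fin by simp
    ultimately have "\<exists>\<V>. finite \<V> \<and> open_cover (top_of_set S) \<V> \<and>
        (\<forall>V\<in>\<V>. \<exists>W\<in>(\<lambda>i. S \<inter> U i) ` I. V \<subseteq> W) \<and>
        (\<forall>x\<in>topspace (top_of_set S). int (card {V \<in> \<V>. x \<in> V}) \<le> m + 1)"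
      using L unfolding covering_dim_le_def by (elim conjE allE impE) (rule conjI)
    then obtain \<V> where \<V>: "finite \<V>" "open_cover (top_of_set S) \<V>"
      "\<forall>V\<in>\<V>. \<exists>W\<in>(\<lambda>i. S \<inter> U i) ` I. V \<subseteq> W" "\<forall>x\<in>S. int (card {V \<in> \<V>. x \<in> V}) \<le> m + 1"
      by auto
    have "\<forall>V\<in>\<V>. \<exists>i. i \<in> I \<and> V \<subseteq> U i"
      using \<V>(3) by auto
    then obtain ix where ix: "\<And>V. V \<in> \<V> \<Longrightarrow> ix V \<in> I \<and> V \<subseteq> U (ix V)"
      by metis
    have "\<forall>V\<in>\<V>. \<exists>T. open T \<and> S \<inter> T = V"
      using \<V>(2) by (auto simp: open_cover_def openin_open)
    then obtain T where T: "\<And>V. V \<in> \<V> \<Longrightarrow> open (T V) \<and> S \<inter> T V = V"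
      by metis
    have S: "\<Union>\<V> = S"
      using \<V>(2) by (simp add: open_cover_def)
    \<comment> \<open>The open extension \<open>T V\<close> of a member may leave
      \<open>U (ix V)\<close> outside \<open>S\<close>, hence the intersection.\<close>
    define W where "W i = U i \<inter> (\<Union>V\<in>{V\<in>\<V>. ix V = i}. T V)" for i
    have "open (W i)" if "i \<in> I" for i
      using op that T unfolding W_def by (intro open_Int open_UN) auto
    moreover have "x \<in> (\<Union>i\<in>I. W i)" if x: "x \<in> S" for x
    proof -
      obtain V where "V \<in> \<V>" "x \<in> V"
        using x S by blast
      then have "x \<in> T V" "x \<in> U (ix V)"
        using ix [of V] T [of V] by auto
      then have "x \<in> W (ix V)"
        using \<open>V \<in> \<V>\<close> by (auto simp: W_def)
      then show ?thesis
        using ix \<open>V \<in> \<V>\<close> by blast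
    qed
    moreover have "int (card {i\<in>I. x \<in> W i}) \<le> m + 1" if x: "x \<in> S" for x
    proof -
      have "{i\<in>I. x \<in> W i} \<subseteq> ix ` {V\<in>\<V>. x \<in> V}"
        using x T by (auto simp: W_def)
      then have "card {i\<in>I. x \<in> W i} \<le> card {V\<in>\<V>. x \<in> V}"
        using \<V>(1) by (intro surj_card_le) auto
      then show ?thesis
        using \<V>(4) x by force
    qed
    ultimately show ?thesis
      by (intro exI [of _ W]) (auto simp: W_def)
  qed
  then have "shrinkable S m"
    unfolding shrinkable_def by (intro allI impI) (elim conjE)
  with L show "-1 \<le> m \<and> shrinkable S m"
    unfolding covering_dim_le_def by simp
next
  assume R: "-1 \<le> m \<and> shrinkable S m"
  have "\<exists>\<V>. finite \<V> \<and> open_cover (top_of_set S) \<V> \<and> (\<forall>V\<in>\<V>. \<exists>U\<in>\<U>. V \<subseteq> U) \<and>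
            (\<forall>x\<in>S. int (card {V \<in> \<V>. x \<in> V}) \<le> m + 1)"
    if fin: "finite \<U>" and cov: "open_cover (top_of_set S) \<U>" for \<U>
  proof -
    have "\<forall>V\<in>\<U>. \<exists>T. open T \<and> S \<inter> T = V"
      using cov by (auto simp: open_cover_def openin_open)
    then obtain T where T: "\<And>V. V \<in> \<U> \<Longrightarrow> open (T V) \<and> S \<inter> T V = V"
      by metis
    have S: "\<Union>\<U> = S"
      using cov by (simp add: open_cover_def)
    have "S \<subseteq> (\<Union>i\<in>\<U>. T i)"
      using S T by blast
    then have "\<exists>V. (\<forall>i\<in>\<U>. open (V i) \<and> V i \<subseteq> T i) \<and> S \<subseteq> (\<Union>i\<in>\<U>. V i) \<and>
          (\<forall>x\<in>S. int (card {i\<in>\<U>. x \<in> V i}) \<le> m + 1)"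
      using R fin T by (intro shrinkableD) auto
    then obtain V where V: "\<And>i. i \<in> \<U> \<Longrightarrow> open (V i) \<and> V i \<subseteq> T i" "S \<subseteq> (\<Union>i\<in>\<U>. V i)"
          "\<And>x. x \<in> S \<Longrightarrow> int (card {i\<in>\<U>. x \<in> V i}) \<le> m + 1"
      by blast
    have "int (card {A \<in> (\<lambda>i. S \<inter> V i) ` \<U>. x \<in> A}) \<le> m + 1" if x: "x \<in> S" for x
    proof -
      have "{A \<in> (\<lambda>i. S \<inter> V i) ` \<U>. x \<in> A} \<subseteq> (\<lambda>i. S \<inter> V i) ` {i\<in>\<U>. x \<in> V i}"
        by auto
      then have "card {A \<in> (\<lambda>i. S \<inter> V i) ` \<U>. x \<in> A} \<le> card {i\<in>\<U>. x \<in> V i}"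
        using fin by (intro surj_card_le) auto
      then show ?thesis
        using V(3) [OF x] by linarith
    qed
    moreover have "\<exists>U\<in>\<U>. A \<subseteq> U" if "A \<in> (\<lambda>i. S \<inter> V i) ` \<U>" for A
      using that V(1) T by blast
    moreover have "open_cover (top_of_set S) ((\<lambda>i. S \<inter> V i) ` \<U>)"
      using V(1,2) by (auto simp: open_cover_def openin_open)
    ultimately show ?thesis
      using fin by (intro exI [of _ "(\<lambda>i. S \<inter> V i) ` \<U>"]) auto
  qed
  then show "covering_dim_le (top_of_set S) m"
    using R unfolding covering_dim_le_def by simp
qed

text \<open>As \<open>A\<close> is closed, its complement can be added to every member, which turns
  a cover of \<open>A\<close> into a cover of \<open>B\<close>; intersecting the shrinking of the
  latter with the sets \<open>U i\<close> removes the addition again.\<close>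

lemma shrinkable_closed_subset:
  assumes "shrinkable B m" "closed A" "A \<subseteq> B"
  shows "shrinkable A m"
  unfolding shrinkable_def
proof (intro allI impI)
  fix I :: "'a set set" and U
  assume U: "finite I \<and> (\<forall>i\<in>I. open (U i)) \<and> A \<subseteq> (\<Union>i\<in>I. U i)"
  show "\<exists>V. (\<forall>i\<in>I. open (V i) \<and> V i \<subseteq> U i) \<and> A \<subseteq> (\<Union>i\<in>I. V i) \<and>
          (\<forall>x\<in>A. int (card {i\<in>I. x \<in> V i}) \<le> m + 1)"
  \<comment> \<open>Without an index there is no member to which \<open>- A\<close> could be added,
    but then \<open>A\<close> is empty.\<close>
  proof (cases "I = {}")
    case True
    then show ?thesis using U by auto
  next
    case False
    then have "B \<subseteq> (\<Union>i\<in>I. U i \<union> - A)"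
      using U by auto
    then have "\<exists>V. (\<forall>i\<in>I. open (V i) \<and> V i \<subseteq> U i \<union> - A) \<and> B \<subseteq> (\<Union>i\<in>I. V i) \<and>
          (\<forall>x\<in>B. int (card {i\<in>I. x \<in> V i}) \<le> m + 1)"
      using assms(1,2) U by (intro shrinkableD) (auto intro!: open_Un)
    then obtain V where V: "\<And>i. i \<in> I \<Longrightarrow> open (V i) \<and> V i \<subseteq> U i \<union> - A" "B \<subseteq> (\<Union>i\<in>I. V i)"
          "\<And>x. x \<in> B \<Longrightarrow> int (card {i\<in>I. x \<in> V i}) \<le> m + 1"
      by blast
    have "x \<in> (\<Union>i\<in>I. V i \<inter> U i)" if x: "x \<in> A" for x
    proof -
      obtain i where "i \<in> I" "x \<in> V i"
        using x assms(3) V(2) by blast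
      then show ?thesis
        using V(1) x by blast
    qed
    moreover have "int (card {i\<in>I. x \<in> V i \<inter> U i}) \<le> m + 1" if x: "x \<in> A" for x
    proof -
      have "card {i\<in>I. x \<in> V i \<inter> U i} \<le> card {i\<in>I. x \<in> V i}"
        using U by (intro card_mono) auto
      then show ?thesis
        using V(3) [of x] x assms(3) by force
    qed
    ultimately show ?thesis
      using U V(1) by (intro exI [of _ "\<lambda>i. V i \<inter> U i"]) auto
  qed
qed

lemma shrinkable_vimage:
  fixes g :: "'a::topological_space \<Rightarrow> 'a"
  assumes "shrinkable S m" "continuous_on UNIV f" "continuous_on UNIV g"
    and gf: "\<And>x. g (f x) = x" and fg: "\<And>x. f (g x) = x"
  shows "shrinkable (g -` S) m"
  unfolding shrinkable_def
proof (intro allI impI)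
  fix I :: "'a set set" and U
  assume U: "finite I \<and> (\<forall>i\<in>I. open (U i)) \<and> g -` S \<subseteq> (\<Union>i\<in>I. U i)"
  have "open (f -` U i)" if "i \<in> I" for i
    using U that assms(2) by (simp add: continuous_on_open_vimage)
  moreover have "S \<subseteq> (\<Union>i\<in>I. f -` U i)"
    using U gf by fastforce
  ultimately have "\<exists>V. (\<forall>i\<in>I. open (V i) \<and> V i \<subseteq> f -` U i) \<and> S \<subseteq> (\<Union>i\<in>I. V i) \<and>
          (\<forall>x\<in>S. int (card {i\<in>I. x \<in> V i}) \<le> m + 1)"
    using assms(1) U by (intro shrinkableD) auto
  then obtain V where V: "\<And>i. i \<in> I \<Longrightarrow> open (V i) \<and> V i \<subseteq> f -` U i" "S \<subseteq> (\<Union>i\<in>I. V i)"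
          "\<And>x. x \<in> S \<Longrightarrow> int (card {i\<in>I. x \<in> V i}) \<le> m + 1"
    by blast
  have "open (g -` V i)" if "i \<in> I" for i
    using V(1) that assms(3) by (simp add: continuous_on_open_vimage)
  moreover have "g -` V i \<subseteq> U i" if "i \<in> I" for i
    using V(1) [OF that] fg by force
  moreover have "g -` S \<subseteq> (\<Union>i\<in>I. g -` V i)"
    using V(2) by blast
  moreover have "\<forall>x\<in>g -` S. int (card {i\<in>I. x \<in> g -` V i}) \<le> m + 1"
    using V(3) by simp
  ultimately show "\<exists>V. (\<forall>i\<in>I. open (V i) \<and> V i \<subseteq> U i) \<and> g -` S \<subseteq> (\<Union>i\<in>I. V i) \<and>
          (\<forall>x\<in>g -` S. int (card {i\<in>I. x \<in> V i}) \<le> m + 1)"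
    by - (rule exI [of _ "\<lambda>i. g -` V i"], intro conjI ballI, blast+)
qed

section \<open>From a ball to the whole plane\<close>

text \<open>Each \<open>A j\<close> is shrunk separately, and from \<open>U i\<close> the part of
  \<open>A j\<close> outside \<open>V j i\<close> is removed. By disjointness the result agrees with
  \<open>V j\<close> on \<open>A j\<close>, and points outside all \<open>A j\<close> lose nothing.
  The distance bound lets only finitely many \<open>A j\<close> meet a bounded set, which keeps the
  result open.\<close>

lemma shrink_on_locally_finite_closed:
  fixes A :: "nat \<Rightarrow> 'a::metric_space set" and I :: "'a set set"
  assumes A: "\<And>j. closed (A j)" "\<And>j. shrinkable (A j) m" "\<And>j x. x \<in> A j \<Longrightarrow> real j \<le> dist a x"
    and disj: "disjoint_family A"
    and I: "finite I" "\<And>i. i \<in> I \<Longrightarrow> open (U i)" "S \<subseteq> (\<Union>i\<in>I. U i)" and AS: "\<And>j. A j \<subseteq> S"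
  shows "\<exists>V. (\<forall>i\<in>I. open (V i) \<and> V i \<subseteq> U i) \<and> S \<subseteq> (\<Union>i\<in>I. V i) \<and>
          (\<forall>x\<in>\<Union>(range A). int (card {i\<in>I. x \<in> V i}) \<le> m + 1)"
proof -
  have "\<forall>j. \<exists>V. (\<forall>i\<in>I. open (V i) \<and> V i \<subseteq> U i) \<and> A j \<subseteq> (\<Union>i\<in>I. V i) \<and>
          (\<forall>x\<in>A j. int (card {i\<in>I. x \<in> V i}) \<le> m + 1)"
    using AS I by (intro allI shrinkableD A) blast+
  from choice [OF this] obtain V where "\<forall>j. (\<forall>i\<in>I. open (V j i) \<and> V j i \<subseteq> U i) \<and> A j \<subseteq> (\<Union>i\<in>I. V j i) \<and>
          (\<forall>x\<in>A j. int (card {i\<in>I. x \<in> V j i}) \<le> m + 1)" ..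
  then have V: "\<And>i j. i \<in> I \<Longrightarrow> open (V j i) \<and> V j i \<subseteq> U i" "\<And>j. A j \<subseteq> (\<Union>i\<in>I. V j i)"
    "\<And>j x. x \<in> A j \<Longrightarrow> int (card {i\<in>I. x \<in> V j i}) \<le> m + 1"
    by simp_all
  define W where "W i = U i - (\<Union>j. A j - V j i)" for i
  have "open (W i)" if i: "i \<in> I" for i
  proof (subst open_subopen, intro ballI)
    fix x assume x: "x \<in> W i"
    obtain J where J: "dist a x < real J"
      using reals_Archimedean2 by blast
    \<comment> \<open>For \<open>j > J\<close> the set \<open>A j\<close> lies outside
      \<open>ball a J\<close>, so near \<open>x\<close> only finitely many closed sets are
      removed.\<close>
    let ?O = "U i \<inter> ball a J - (\<Union>j\<in>{..J}. A j - V j i)"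
    have "open ?O"
      using i I(2) V(1) A(1) by (intro open_Diff open_Int open_ball closed_UN) (auto intro: closed_Diff)
    moreover have "x \<in> ?O"
      using x J by (auto simp: W_def)
    moreover have "?O \<subseteq> W i"
    proof
      fix y assume y: "y \<in> ?O"
      have "y \<notin> A j - V j i" for j
      proof (cases "j \<le> J")
        case False
        then show ?thesis
          using y A(3) [of y j] by force
      qed (use y in auto)
      then show "y \<in> W i"
        using y by (auto simp: W_def)
    qed
    ultimately show "\<exists>T. open T \<and> x \<in> T \<and> T \<subseteq> W i"
      by blast
  qed
  moreover have mem: "x \<in> W i \<longleftrightarrow> x \<in> V j i" if "x \<in> A j" "i \<in> I" for x i j
  proof -
    have "x \<in> A k \<longleftrightarrow> k = j" for k
      using disj \<open>x \<in> A j\<close> by (auto simp: disjoint_family_on_def)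
    then show ?thesis
      using V(1) [OF that(2), of j] by (auto simp: W_def)
  qed
  moreover have "x \<in> (\<Union>i\<in>I. W i)" if x: "x \<in> S" for x
  proof (cases "\<exists>j. x \<in> A j")
    case True
    then show ?thesis
      using V(2) mem by blast
  next
    case False
    then show ?thesis
      using I(3) x by (auto simp: W_def)
  qed
  moreover have "int (card {i\<in>I. x \<in> W i}) \<le> m + 1" if "x \<in> A j" for x j
  proof -
    have "{i\<in>I. x \<in> W i} = {i\<in>I. x \<in> V j i}"
      using mem [OF that] by auto
    then show ?thesis
      using V(3) [OF that] by simp
  qed
  ultimately show ?thesis
    by (intro exI [of _ W]) (auto simp: W_def)
qed

text \<open>The annuli \<open>j \<le> dist a x \<le> j + 1\<close> with \<open>j\<close> even are pairwise disjoint, and so are those with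
  \<open>j\<close> odd, so two rounds of shrinking suffice.\<close>

lemma shrinkable_if_bounded_parts:
  fixes S :: "'a::metric_space set"
  assumes S: "closed S" and b: "\<And>r. shrinkable (S \<inter> cball a r) m"
  shows "shrinkable S m"
  unfolding shrinkable_def
proof (intro allI impI)
  fix I :: "'a set set" and U
  assume U: "finite I \<and> (\<forall>i\<in>I. open (U i)) \<and> S \<subseteq> (\<Union>i\<in>I. U i)"
  define A where "A k j = {x\<in>S. real (2 * j + k) \<le> dist a x \<and> dist a x \<le> real (2 * j + k + 1)}" for k j :: nat
  have cl: "closed (A k j)" for k j
  proof -
    have "A k j = S \<inter> {x. real (2 * j + k) \<le> dist a x} \<inter> {x. dist a x \<le> real (2 * j + k + 1)}"
      by (auto simp: A_def)
    then show ?thesis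
      using S by (auto intro!: closed_Int closed_Collect_le continuous_intros)
  qed
  have sh: "shrinkable (A k j) m" for k j
    by (rule shrinkable_closed_subset [OF b cl, of k j "real (2 * j + k + 1)"]) (auto simp: A_def)
  have disj: "disjoint_family (A k)" for k
  proof -
    have "A k i \<inter> A k j = {}" if "i < j" for i j
    proof -
      have "real (2 * i + k + 1) < real (2 * j + k)"
        using that by simp
      then show ?thesis
        by (auto simp: A_def)
    qed
    then show ?thesis
      unfolding disjoint_family_on_def by (metis inf_commute linorder_neqE_nat)
  qed
  have dist: "real j \<le> dist a x" if "x \<in> A k j" for k j x
    using that by (auto simp: A_def)
  have AS: "A k j \<subseteq> S" for k j
    by (auto simp: A_def)
  have "\<exists>V. (\<forall>i\<in>I. open (V i) \<and> V i \<subseteq> U i) \<and> S \<subseteq> (\<Union>i\<in>I. V i) \<and>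
          (\<forall>x\<in>\<Union>(range (A 0)). int (card {i\<in>I. x \<in> V i}) \<le> m + 1)"
    using U by (intro shrink_on_locally_finite_closed [where a=a] cl sh disj AS) (auto simp: dist)
  then obtain V where "(\<forall>i\<in>I. open (V i) \<and> V i \<subseteq> U i) \<and> S \<subseteq> (\<Union>i\<in>I. V i) \<and>
          (\<forall>x\<in>\<Union>(range (A 0)). int (card {i\<in>I. x \<in> V i}) \<le> m + 1)" ..
  then have V: "\<And>i. i \<in> I \<Longrightarrow> open (V i) \<and> V i \<subseteq> U i" "S \<subseteq> (\<Union>i\<in>I. V i)"
    "\<And>x j. x \<in> A 0 j \<Longrightarrow> int (card {i\<in>I. x \<in> V i}) \<le> m + 1"
    by auto
  \<comment> \<open>The second round starts from \<open>V\<close> instead of \<open>U\<close>;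
    orders can only drop, so the bound reached on the even annuli survives.\<close>
  have "\<exists>W. (\<forall>i\<in>I. open (W i) \<and> W i \<subseteq> V i) \<and> S \<subseteq> (\<Union>i\<in>I. W i) \<and>
          (\<forall>x\<in>\<Union>(range (A 1)). int (card {i\<in>I. x \<in> W i}) \<le> m + 1)"
    using U V by (intro shrink_on_locally_finite_closed [where a=a] cl sh disj AS) (auto simp: dist)
  then obtain W where "(\<forall>i\<in>I. open (W i) \<and> W i \<subseteq> V i) \<and> S \<subseteq> (\<Union>i\<in>I. W i) \<and>
          (\<forall>x\<in>\<Union>(range (A 1)). int (card {i\<in>I. x \<in> W i}) \<le> m + 1)" ..
  then have W: "\<And>i. i \<in> I \<Longrightarrow> open (W i) \<and> W i \<subseteq> V i" "S \<subseteq> (\<Union>i\<in>I. W i)"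
    "\<And>x j. x \<in> A 1 j \<Longrightarrow> int (card {i\<in>I. x \<in> W i}) \<le> m + 1"
    by auto
  have "int (card {i\<in>I. x \<in> W i}) \<le> m + 1" if x: "x \<in> S" for x
  proof -
    define n where "n = nat \<lfloor>dist a x\<rfloor>"
    have n: "real n \<le> dist a x" "dist a x \<le> real (n + 1)"
      unfolding n_def by (simp, linarith)
    show ?thesis
    proof (cases "even n")
      case True
      then have "x \<in> A 0 (n div 2)"
        using n x by (auto simp: A_def)
      then have "int (card {i\<in>I. x \<in> V i}) \<le> m + 1"
        by (rule V(3))
      moreover have "card {i\<in>I. x \<in> W i} \<le> card {i\<in>I. x \<in> V i}"
        using U W(1) by (intro card_mono) auto
      ultimately show ?thesis
        by linarith
    next
      case False
      then have "n = 2 * (n div 2) + 1"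
        by presburger
      then have "x \<in> A 1 (n div 2)"
        using n x unfolding A_def by simp
      then show ?thesis
        by (rule W(3))
    qed
  qed
  then show "\<exists>V. (\<forall>i\<in>I. open (V i) \<and> V i \<subseteq> U i) \<and> S \<subseteq> (\<Union>i\<in>I. V i) \<and>
          (\<forall>x\<in>S. int (card {i\<in>I. x \<in> V i}) \<le> m + 1)"
    using W V(1) by (intro exI [of _ W]) blast
qed

text \<open>A homothety about \<open>a\<close> carries any bounded part of \<open>P\<close> into the
  given ball, and pulling back along it preserves shrinkability; the bounded parts then
  suffice.\<close>

lemma shrinkable_affine_if_ball:
  fixes P :: "'a::euclidean_space set"
  assumes P: "affine P" "a \<in> P" and "0 < r" and b: "shrinkable (P \<inter> cball a r) m"
  shows "shrinkable P m"
proof (rule shrinkable_if_bounded_parts)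
  show "closed P"
    using P(1) by (rule affine_closed)
next
  fix R :: real
  \<comment> \<open>\<open>R\<close> is an arbitrary real, so \<open>\<bar>R\<bar> + 1\<close> is
    what keeps \<open>s\<close> positive.\<close>
  define s where "s = r / (\<bar>R\<bar> + 1)"
  have s: "s > 0" "s * R \<le> r"
    using \<open>0 < r\<close> by (auto simp: s_def field_simps abs_if)
  define f g where "f x = a + (1 / s) *\<^sub>R (x - a)" and "g x = a + s *\<^sub>R (x - a)" for x :: 'a
  have "shrinkable (g -` (P \<inter> cball a r)) m"
  proof (rule shrinkable_vimage [OF b])
    show "continuous_on UNIV f" "continuous_on UNIV g"
      unfolding f_def g_def by (intro continuous_intros)+
    show "g (f x) = x" "f (g x) = x" for x
      using s by (simp_all add: f_def g_def)
  qed
  moreover have "P \<inter> cball a R \<subseteq> g -` (P \<inter> cball a r)"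
  proof
    fix x assume x: "x \<in> P \<inter> cball a R"
    have "g x = (1 - s) *\<^sub>R a + s *\<^sub>R x"
      by (simp add: g_def algebra_simps)
    then have "g x \<in> P"
      using P x by (simp add: mem_affine)
    moreover have "dist a (g x) = s * dist a x"
      using s by (simp add: g_def dist_norm norm_minus_commute)
    then have "dist a (g x) \<le> s * R"
      using x s by simp
    ultimately show "x \<in> g -` (P \<inter> cball a r)"
      using s by auto
  qed
  moreover have "closed (P \<inter> cball a R)"
    using P by (intro closed_Int affine_closed closed_cball)
  ultimately show "shrinkable (P \<inter> cball a R) m"
    by (blast intro: shrinkable_closed_subset)
qed

text \<open>No dimension is computed. \<open>A\<close> lies between a ball of \<open>P\<close> and
  \<open>P\<close>, so each bound \<open>m\<close> passes from \<open>P\<close> to \<open>A\<close>,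
  from \<open>A\<close> to the ball, and from the ball back to \<open>P\<close>.\<close>

lemma covering_dim_eq_affine:
  fixes P :: "'a::euclidean_space set"
  assumes P: "affine P" "a \<in> P" and "0 < r" and A: "closed A" "A \<subseteq> P" "P \<inter> cball a r \<subseteq> A"
  shows "covering_dim (top_of_set A) = covering_dim (top_of_set P)"
proof -
  have "shrinkable A m \<longleftrightarrow> shrinkable P m" for m
  proof
    assume m: "shrinkable A m"
    have "shrinkable (P \<inter> cball a r) m"
      using A(3) P(1) by (intro shrinkable_closed_subset [OF m]) (simp_all add: affine_closed closed_Int)
    then show "shrinkable P m"
      by (rule shrinkable_affine_if_ball [OF P \<open>0 < r\<close>])
  qed (use A shrinkable_closed_subset in blast)
  then show ?thesis
    by (simp add: covering_dim_def covering_dim_le_iff_shrinkable)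
qed

section \<open>Cantor sets and the Alexander trick\<close>

text \<open>The Alexander trick: conjugating \<open>h\<close> by the scaling with factor
  \<open>t\<close> multiplies its displacement by \<open>t\<close>, so these maps tend uniformly to
  the identity as \<open>t\<close> tends to 0, while \<open>t = 1\<close> gives
  \<open>h\<close>.\<close>

lemma eps_isotopy_of_bounded_homeomorphism:
  fixes h :: "'a::real_normed_vector \<Rightarrow> 'a"
  assumes hom: "homeomorphism UNIV UNIV h k" and bd: "\<And>x. dist (h x) x \<le> \<epsilon>"
  obtains H where "eps_isotopy \<epsilon> H" "H 1 = h"
proof -
  \<comment> \<open>This is \<open>t f(x/t)\<close> for \<open>t \<noteq> 0\<close>, and the identity for \<open>t = 0\<close>, where \<open>x /\<^sub>R 0 = 0\<close>.\<close>
  define A where "A f t x = x + t *\<^sub>R (f (x /\<^sub>R t) - x /\<^sub>R t)" for f :: "'a \<Rightarrow> 'a" and t :: real and x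
  have A_nz: "A f t x = t *\<^sub>R f (x /\<^sub>R t)" if "t \<noteq> 0" for f t x
    using that by (simp add: A_def scaleR_diff_right)
  have A_0: "A f 0 x = x" for f x
    by (simp add: A_def)
  have A_dist: "dist (A f t x) x \<le> \<bar>t\<bar> * \<epsilon>" if "\<And>x. dist (f x) x \<le> \<epsilon>" for f t x
  proof -
    have "dist (A f t x) x = \<bar>t\<bar> * dist (f (x /\<^sub>R t)) (x /\<^sub>R t)"
      by (simp add: A_def dist_norm)
    also have "\<dots> \<le> \<bar>t\<bar> * \<epsilon>"
      by (intro mult_left_mono that) auto
    finally show ?thesis .
  qed
  have A_cont: "continuous_on (UNIV \<times> {0..1}) (\<lambda>(x, t). (A f t x, t))"
    if f: "continuous_on UNIV f" and fb: "\<And>x. dist (f x) x \<le> \<epsilon>" for f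
  proof -
    have "isCont (\<lambda>p. A f (snd p) (fst p)) (x, t)" for x t
    proof (cases "t = 0")
      case True
      \<comment> \<open>At \<open>t = 0\<close> continuity comes from the displacement bound
        \<open>\<bar>t\<bar> * \<epsilon>\<close>, which is uniform in \<open>x\<close>.\<close>
      have "((\<lambda>p. A f (snd p) (fst p) - fst p) \<longlongrightarrow> 0) (at (x, 0))"
      proof (rule Lim_null_comparison)
        show "\<forall>\<^sub>F p in at (x, 0). norm (A f (snd p) (fst p) - fst p) \<le> \<bar>snd p\<bar> * \<epsilon>"
          using A_dist [OF fb] by (simp add: dist_norm)
        show "((\<lambda>p. \<bar>snd p\<bar> * \<epsilon>) \<longlongrightarrow> 0) (at (x, 0::real))"
          by (rule tendsto_eq_intros refl | simp)+
      qed
      moreover have "(fst \<longlongrightarrow> x) (at (x, 0::real))"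
        by (rule tendsto_eq_intros refl | simp)+
      ultimately have "((\<lambda>p. (A f (snd p) (fst p) - fst p) + fst p) \<longlongrightarrow> 0 + x) (at (x, 0))"
        by (rule tendsto_add)
      then show ?thesis
        using True by (simp add: isCont_def A_0)
    next
      case False
      have f': "isCont f y" for y
        using f by (simp add: continuous_on_eq_continuous_at)
      have c: "isCont (\<lambda>p. fst p /\<^sub>R snd p) (x, t)"
        using False by (intro continuous_intros) auto
      have "isCont (\<lambda>p. f (fst p /\<^sub>R snd p)) (x, t)"
        by (rule isCont_o2 [OF c f'])
      then show ?thesis
        unfolding A_def using c
        by (intro continuous_add continuous_scaleR [OF isCont_snd] continuous_diff isCont_fst continuous_ident)
    qed
    then have "continuous_on UNIV (\<lambda>p. A f (snd p) (fst p))"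
      by (simp add: continuous_on_eq_continuous_at)
    then have "continuous_on (UNIV \<times> {0..1}) (\<lambda>p. (A f (snd p) (fst p), snd p))"
      by (intro continuous_intros) (auto intro: continuous_on_subset)
    then show ?thesis
      by (simp add: case_prod_beta)
  qed
  have hk: "k (h x) = x" "h (k x) = x" for x
    using hom by (auto simp: homeomorphism_def)
  have inv: "A f t (A g t x) = x" if "\<And>x. f (g x) = x" for f g t x
    using that by (cases "t = 0") (simp_all add: A_0 A_nz)
  have kb: "dist (k x) x \<le> \<epsilon>" for x
    using bd [of "k x"] hk by (simp add: dist_commute)
  \<comment> \<open>The inverse is the same construction applied to \<open>k\<close>, which inherits
    the displacement bound of \<open>h\<close>.\<close>
  have "homeomorphism (UNIV \<times> {0..1}) (UNIV \<times> {0..1}) (\<lambda>(x, t). (A h t x, t)) (\<lambda>(x, t). (A k t x, t))"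
  proof (rule homeomorphismI)
    show "continuous_on (UNIV \<times> {0..1}) (\<lambda>(x, t). (A h t x, t))"
      "continuous_on (UNIV \<times> {0..1}) (\<lambda>(x, t). (A k t x, t))"
      using A_cont bd kb hom by (auto simp: homeomorphism_def)
  qed (auto simp: inv hk)
  moreover have "A h 0 = id"
    by (rule ext) (simp add: A_0)
  moreover have "dist (A h t x) x \<le> \<epsilon>" if "t \<in> {0..1}" for t x
  proof -
    have "0 \<le> \<epsilon>"
      using bd [of x] zero_le_dist order_trans by blast
    then have "\<bar>t\<bar> * \<epsilon> \<le> \<epsilon>"
      using that by (simp add: mult_left_le_one_le)
    then show ?thesis
      using A_dist [OF bd, of t x] by linarith
  qed
  ultimately have "eps_isotopy \<epsilon> (A h)"
    unfolding eps_isotopy_def isotopy_def by blast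
  moreover have "A h 1 = h"
    by (rule ext) (simp add: A_nz)
  ultimately show ?thesis
    using that by blast
qed

section \<open>Self-similarity of the middle-thirds set and absence of isolated points\<close>

lemma standard_cantor_set_maps:
  assumes "x \<in> standard_cantor_set"
  shows "x / 3 \<in> standard_cantor_set" "2 / 3 + x / 3 \<in> standard_cantor_set"
proof -
  have x: "x \<in> middle_thirds_stage n" for n
    using assms by (simp add: standard_cantor_set_def)
  have "0 \<le> x" "x \<le> 1"
    using x [of 0] by auto
  then have "x / 3 \<in> middle_thirds_stage n \<and> 2 / 3 + x / 3 \<in> middle_thirds_stage n" for n
    using x by (cases n) auto
  then show "x / 3 \<in> standard_cantor_set" "2 / 3 + x / 3 \<in> standard_cantor_set"
    by (auto simp: standard_cantor_set_def)
qed

lemma middle_thirds_stage_bounds: "middle_thirds_stage n \<subseteq> {0..1}"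
  by (induction n) auto

lemma standard_cantor_set_cases:
  assumes "x \<in> standard_cantor_set"
  obtains y where "y \<in> standard_cantor_set" "x = y / 3 \<or> x = 2 / 3 + y / 3"
proof -
  have "x \<in> middle_thirds_stage (Suc n)" for n
    using assms unfolding standard_cantor_set_def by blast
  then have x: "(\<exists>y\<in>middle_thirds_stage n. x = y / 3) \<or> (\<exists>y\<in>middle_thirds_stage n. x = 2 / 3 + y / 3)" for n
    by (auto simp: image_iff)
  show ?thesis
  \<comment> \<open>Each stage offers its own choice between the two contractions; comparing
    \<open>x\<close> with 1/3 makes the choice the same at all stages, so that one preimage works
    for every \<open>n\<close>.\<close>
  proof (cases "x \<le> 1 / 3")
    case True
    have "3 * x \<in> middle_thirds_stage n" for n
      using x [of n] middle_thirds_stage_bounds [of n] True by (auto simp: subset_iff mult.commute)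
    then show ?thesis
      by (intro that [of "3 * x"]) (auto simp: standard_cantor_set_def)
  next
    case False
    have "3 * x - 2 \<in> middle_thirds_stage n" for n
      using x [of n] middle_thirds_stage_bounds [of n] False by (auto simp: subset_iff)
    then show ?thesis
      by (intro that [of "3 * x - 2"]) (auto simp: standard_cantor_set_def field_simps)
  qed
qed

lemma zero_one_in_standard_cantor_set: "0 \<in> standard_cantor_set" "1 \<in> standard_cantor_set"
proof -
  have "0 \<in> middle_thirds_stage n \<and> 1 \<in> middle_thirds_stage n" for n
    by (induction n) (auto simp: image_iff intro!: bexI [of _ 0] bexI [of _ 1])
  then show "0 \<in> standard_cantor_set" "1 \<in> standard_cantor_set"
    by (auto simp: standard_cantor_set_def)
qed

lemma compact_standard_cantor_set: "compact standard_cantor_set"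
proof -
  have "compact (middle_thirds_stage n)" for n
    by (induction n) (auto intro!: compact_Un compact_continuous_image continuous_intros)
  then show ?thesis
    unfolding standard_cantor_set_def by (intro compact_Inter) auto
qed

text \<open>The contraction that carries \<open>x'\<close> to \<open>x\<close> carries a neighbour
  of \<open>x'\<close> to a neighbour of \<open>x\<close> at a third of the distance. The induction
  starts with whichever of 0 and 1 differs from \<open>x\<close>.\<close>

lemma standard_cantor_set_near:
  "x \<in> standard_cantor_set \<Longrightarrow> \<exists>y\<in>standard_cantor_set. y \<noteq> x \<and> \<bar>y - x\<bar> \<le> (1 / 3) ^ n"
proof (induction n arbitrary: x)
  case 0
  have "0 \<le> x" "x \<le> 1"
    using 0 INT_D [of x middle_thirds_stage UNIV 0] by (auto simp: standard_cantor_set_def)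
  then show ?case
    using zero_one_in_standard_cantor_set
    by (cases "x = 0") (auto intro: bexI [of _ 0] bexI [of _ 1])
next
  case (Suc n)
  obtain x' where x': "x' \<in> standard_cantor_set" "x = x' / 3 \<or> x = 2 / 3 + x' / 3"
    using standard_cantor_set_cases [OF Suc.prems] by blast
  obtain y' where y': "y' \<in> standard_cantor_set" "y' \<noteq> x'" "\<bar>y' - x'\<bar> \<le> (1 / 3) ^ n"
    using Suc.IH [OF x'(1)] by blast
  have "\<bar>y' / 3 - x' / 3\<bar> \<le> (1 / 3) ^ Suc n"
    using y'(3) by (simp flip: diff_divide_distrib)
  show ?case
    using x'(2)
  proof
    assume "x = x' / 3"
    then show ?thesis
      using y' standard_cantor_set_maps(1) [OF y'(1)] \<open>\<bar>y' / 3 - x' / 3\<bar> \<le> _\<close>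
      by (intro bexI [of _ "y' / 3"]) auto
  next
    assume "x = 2 / 3 + x' / 3"
    then show ?thesis
      using y' standard_cantor_set_maps(2) [OF y'(1)] \<open>\<bar>y' / 3 - x' / 3\<bar> \<le> _\<close>
      by (intro bexI [of _ "2 / 3 + y' / 3"]) auto
  qed
qed

lemma standard_cantor_set_islimpt:
  assumes "x \<in> standard_cantor_set"
  shows "x islimpt standard_cantor_set"
  unfolding islimpt_approachable
proof (intro allI impI)
  fix e :: real assume "e > 0"
  then obtain n where "(1 / 3 :: real) ^ n < e"
    using real_arch_pow_inv [of e "1/3"] by auto
  then show "\<exists>y\<in>standard_cantor_set. y \<noteq> x \<and> dist y x < e"
    using standard_cantor_set_near [OF assms, of n] by (force simp: dist_real_def)
qed

text \<open>The later construction sees a Cantor set only through these three facts, all transported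
  from the middle-thirds set.\<close>

lemma
  fixes K :: "'a::metric_space set"
  assumes "is_cantor_set K"
  shows compact_cantor_set: "compact K"
    and cantor_set_nonempty: "K \<noteq> {}"
    and cantor_set_islimpt: "\<And>z. z \<in> K \<Longrightarrow> z islimpt K"
proof -
  let ?C = "standard_cantor_set"
  obtain f g where fg: "homeomorphism ?C K f g"
    using assms homeomorphic_sym unfolding is_cantor_set_def homeomorphic_def by blast
  show "compact K"
    using fg compact_standard_cantor_set by (metis compact_continuous_image homeomorphism_def)
  show "K \<noteq> {}"
    using fg zero_one_in_standard_cantor_set by (auto simp: homeomorphism_def)
  fix z assume z: "z \<in> K"
  have gz: "g z \<in> ?C" "f (g z) = z"
    using fg z by (auto simp: homeomorphism_def)
  show "z islimpt K"
    unfolding islimpt_approachable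
  proof (intro allI impI)
    fix e :: real assume "e > 0"
    moreover have "continuous_on ?C f"
      using fg by (simp add: homeomorphism_def)
    ultimately obtain d where d: "d > 0" "\<And>y. y \<in> ?C \<Longrightarrow> dist y (g z) < d \<Longrightarrow> dist (f y) z < e"
      using gz unfolding continuous_on_iff by metis
    obtain y where y: "y \<in> ?C" "y \<noteq> g z" "dist y (g z) < d"
      using standard_cantor_set_islimpt [OF gz(1)] d(1) unfolding islimpt_approachable by blast
    then have "f y \<noteq> z" "f y \<in> K"
      using fg by (auto simp: homeomorphism_def)
    then show "\<exists>x\<in>K. x \<noteq> z \<and> dist x z < e"
      using d(2) y by blast
  qed
qed

section \<open>Cells blocking lines\<close>

text \<open>The range is open by invariance of domain. It is closed because points with values
  within 1 of \<open>y\<close> lie in the compact ball of radius \<open>1 + B\<close> about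
  \<open>y\<close>. Connectedness of the space then gives surjectivity.\<close>

lemma continuous_inj_bounded_displacement_bij:
  fixes f :: "'a::euclidean_space \<Rightarrow> 'a"
  assumes cont: "continuous_on UNIV f" and inj: "inj f" and bd: "\<And>x. dist (f x) x \<le> B"
  shows "bij f"
proof -
  have "open (range f)"
    using invariance_of_domain [OF cont open_UNIV inj] .
  moreover have "closed (range f)"
  proof -
    have "y \<in> range f" if y: "y \<in> closure (range f)" for y
    proof -
      have "compact (f ` cball y (1 + B))"
        by (intro compact_continuous_image continuous_on_subset [OF cont]) auto
      then have cl: "closed (f ` cball y (1 + B))"
        by (rule compact_imp_closed)
      have "y \<in> closure (f ` cball y (1 + B))"
        unfolding closure_approachable
      proof (intro allI impI)
        fix e :: real assume "e > 0"
        then obtain x where x: "dist (f x) y < min e 1"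
          using y unfolding closure_approachable by (metis imageE min_less_iff_conj zero_less_one)
        then have "dist y x \<le> 1 + B"
          using bd [of x] dist_triangle [of y x "f x"] by (simp add: dist_commute)
        then show "\<exists>z\<in>f ` cball y (1 + B). dist z y < e"
          using x by auto
      qed
      then show ?thesis
        using cl by auto
    qed
    then show ?thesis
      by (metis closure_subset closed_closure subsetI subset_antisym)
  qed
  ultimately have "range f = UNIV"
    using clopen [of "range f"] by auto
  with inj show ?thesis
    by (simp add: bij_def)
qed

lemma bij_supported_mem:
  assumes "bij g" "\<And>x. x \<notin> C \<Longrightarrow> g x = x" "x \<in> C"
  shows "g x \<in> C"
  using assms by (metis bij_pointE)

text \<open>The maps are composed one after another. Each \<open>f i\<close> is a bijection fixing
  the complement of \<open>D i\<close>, so it maps \<open>D i\<close> to itself, where the other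
  maps are the identity.\<close>

lemma glue_disjoint_supports:
  fixes f :: "'i \<Rightarrow> 'a::topological_space \<Rightarrow> 'a"
  assumes "finite I" "\<And>i. i \<in> I \<Longrightarrow> continuous_on UNIV (f i)" "\<And>i. i \<in> I \<Longrightarrow> bij (f i)"
    "\<And>i x. i \<in> I \<Longrightarrow> x \<notin> D i \<Longrightarrow> f i x = x" "disjoint_family_on D I"
  shows "\<exists>F. continuous_on UNIV F \<and> bij F \<and> (\<forall>i\<in>I. \<forall>x\<in>D i. F x = f i x) \<and>
             (\<forall>x. x \<notin> (\<Union>i\<in>I. D i) \<longrightarrow> F x = x)"
  using assms
proof (induction I rule: finite_induct)
  case empty
  then show ?case
    by (intro exI [of _ id] conjI continuous_on_id continuous_on_id' bij_id) simp_all
next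
  case (insert j I)
  have "disjoint_family_on D I"
    using insert.prems(4) by (rule disjoint_family_on_mono [rotated]) auto
  then have "\<exists>F. continuous_on UNIV F \<and> bij F \<and> (\<forall>i\<in>I. \<forall>x\<in>D i. F x = f i x) \<and>
             (\<forall>x. x \<notin> (\<Union>i\<in>I. D i) \<longrightarrow> F x = x)"
    using insert.prems by (intro insert.IH) auto
  then obtain F where F: "continuous_on UNIV F" "bij F" "\<And>i x. i \<in> I \<Longrightarrow> x \<in> D i \<Longrightarrow> F x = f i x"
      "\<And>x. x \<notin> (\<Union>i\<in>I. D i) \<Longrightarrow> F x = x"
    by blast
  have disj: "D i \<inter> D j = {}" if "i \<in> I" for i
    using insert.prems(4) that insert.hyps(2) by (auto simp: disjoint_family_on_def)
  have j: "continuous_on UNIV (f j)" "bij (f j)" "\<And>x. x \<notin> D j \<Longrightarrow> f j x = x"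
    using insert.prems by auto
  have "continuous_on UNIV (f j \<circ> F)"
    using F(1) j(1) by (metis continuous_on_compose continuous_on_subset subset_UNIV)
  moreover have "bij (f j \<circ> F)"
    using F(2) j(2) by (rule bij_comp)
  moreover have "(f j \<circ> F) x = f i x" if "i \<in> insert j I" "x \<in> D i" for i x
  proof (cases "i = j")
    case True
    then have "F x = x"
      using F(4) disj that by (metis UN_E disjoint_iff)
    with True show ?thesis by simp
  next
    case False
    with that have i: "i \<in> I" by simp
    have "f i x \<in> D i"
      using bij_supported_mem [of "f i" "D i" x] insert.prems i that by auto
    then have "f j (f i x) = f i x"
      using j(3) disj [OF i] by auto
    then show ?thesis
      using F(3) i that by auto
  qed
  moreover have "(f j \<circ> F) x = x" if "x \<notin> (\<Union>i\<in>insert j I. D i)" for x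
    using that F(4) j(3) by auto
  ultimately show ?case
    by blast
qed

section \<open>Flat cells and their children\<close>

text \<open>The part of a ball within a slab orthogonal to \<open>u\<close>. Radius and half-height
  are separate parameters so that cells can be made very flat.\<close>

definition cell :: "'a::euclidean_space \<Rightarrow> 'a \<Rightarrow> real \<Rightarrow> real \<Rightarrow> 'a set" where
  "cell u c r h = {x. dist c x \<le> r \<and> \<bar>u \<bullet> (x - c)\<bar> \<le> h}"

lemma compact_cell: "compact (cell u c r h)"
proof -
  have "cell u c r h = cball c r \<inter> {x. \<bar>u \<bullet> (x - c)\<bar> \<le> h}"
    by (auto simp: cell_def)
  moreover have "closed {x. \<bar>u \<bullet> (x - c)\<bar> \<le> h}"
    by (intro closed_Collect_le continuous_intros)
  ultimately show ?thesis
    by (simp add: compact_Int_closed)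
qed

lemma centre_in_cell: "0 < r \<Longrightarrow> 0 < h \<Longrightarrow> c \<in> cell u c r h"
  by (simp add: cell_def)

text \<open>The map rescales each ray from \<open>c\<close> by a factor that depends only on the
  gauge of the cell: a small constant on the cell and 1 outside the doubled cell.\<close>

lemma cell_radial_shrink:
  fixes u c :: "'a::euclidean_space"
  assumes "0 < r" "0 < h" "0 < \<sigma>"
  obtains s where "continuous_on UNIV s" "bij s" "s c = c"
    "\<And>x. x \<notin> cell u c (2 * r) (2 * h) \<Longrightarrow> s x = x"
    "\<And>x. x \<in> cell u c r h \<Longrightarrow> dist c (s x) \<le> \<sigma>"
proof -
  \<comment> \<open>The Minkowski functional of the cell moved to the origin:
    \<open>N \<le> 1\<close> on the cell and \<open>N \<le> 2\<close> on the doubled cell.\<close>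
  define N where "N x = max (norm x / r) (\<bar>u \<bullet> x\<bar> / h)" for x
  define \<tau> where "\<tau> = min 1 (\<sigma> / r)"
  \<comment> \<open>Nondecreasing, equal to \<open>\<tau>\<close> for \<open>t \<le> 1\<close> and
    to 1 for \<open>t \<ge> 2\<close>.\<close>
  define l where "l t = max \<tau> (min 1 (t - 1))" for t :: real
  define s where "s x = c + l (N (x - c)) *\<^sub>R (x - c)" for x
  have \<tau>: "0 < \<tau>" "\<tau> \<le> 1" "\<tau> * r \<le> \<sigma>"
    using assms by (auto simp: \<tau>_def min_def field_simps)
  have l: "0 < l t" "l t \<le> 1" "a \<le> b \<Longrightarrow> l a \<le> l b" for t a b
    using \<tau> by (auto simp: l_def)
  have N_nonneg: "0 \<le> N x" for x
    using assms by (auto simp: N_def le_max_iff_disj)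
  have N_scale: "N (a *\<^sub>R x) = a * N x" if "0 < a" for a x
    using that by (simp add: N_def abs_mult max_mult_distrib_left)
  have cont: "continuous_on UNIV s"
    unfolding s_def l_def N_def using assms by (intro continuous_intros) auto
  have inj: "inj s"
  proof (rule injI)
    fix x y assume eq: "s x = s y"
    let ?a = "N (x - c)" and ?b = "N (y - c)"
    have e: "l ?a *\<^sub>R (x - c) = l ?b *\<^sub>R (y - c)"
      using eq by (simp add: s_def)
    \<comment> \<open>Applying \<open>N\<close> reduces injectivity to numbers:
      \<open>l t * t\<close> is strictly increasing for \<open>t \<ge> 0\<close>, so the gauges
      agree, hence the factors, hence the points.\<close>
    then have ab: "l ?a * ?a = l ?b * ?b"
      by (metis N_scale l(1))
    have mono: "l a * a < l b * b" if "0 \<le> a" "a < b" for a b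
      using that l by (meson less_eq_real_def mult_left_mono mult_strict_left_mono mult_right_mono order_le_less_trans le_less_trans)
    have "?a = ?b"
      using ab mono N_nonneg by (metis less_irrefl linorder_neqE_linordered_idom)
    then show "x = y"
      using e l(1) [of ?b] by simp
  qed
  have id: "s x = x" if "x \<notin> cell u c (2 * r) (2 * h)" for x
  proof -
    have "2 < N (x - c)"
      using that assms by (auto simp: cell_def N_def dist_norm norm_minus_commute less_max_iff_disj field_simps)
    then have "l (N (x - c)) = 1"
      using \<tau> by (simp add: l_def)
    then show ?thesis
      by (simp add: s_def)
  qed
  have dist_le: "dist (s x) x \<le> 2 * r" for x
  proof (cases "x \<in> cell u c (2 * r) (2 * h)")
    case True
    have "s x - x = (l (N (x - c)) - 1) *\<^sub>R (x - c)"
      by (simp add: s_def algebra_simps)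
    then have "dist (s x) x = \<bar>l (N (x - c)) - 1\<bar> * norm (x - c)"
      by (simp add: dist_norm)
    also have "\<dots> \<le> 1 * norm (x - c)"
      using l(1,2) [of "N (x - c)"] by (intro mult_right_mono) auto
    also have "\<dots> \<le> 2 * r"
      using True by (simp add: cell_def dist_norm norm_minus_commute)
    finally show ?thesis .
  next
    case False
    then show ?thesis
      using id assms by simp
  qed
  have small: "dist c (s x) \<le> \<sigma>" if "x \<in> cell u c r h" for x
  proof -
    have "N (x - c) \<le> 1"
      using that assms by (auto simp: cell_def N_def dist_norm norm_minus_commute field_simps)
    then have "l (N (x - c)) = \<tau>"
      using \<tau> by (simp add: l_def)
    then have "dist c (s x) = \<tau> * norm (x - c)"
      using \<tau> by (simp add: s_def dist_norm)
    also have "\<dots> \<le> \<tau> * r"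
      using that \<tau> by (intro mult_left_mono) (auto simp: cell_def dist_norm norm_minus_commute)
    finally show ?thesis
      using \<tau> by simp
  qed
  show ?thesis
    using that cont continuous_inj_bounded_displacement_bij [OF cont inj dist_le] id small
    by (simp add: s_def)
qed

text \<open>A line with direction \<open>v\<close>, \<open>v \<bullet> u = 1\<close>, is tracked by its point at the height of the
  centre of a cell.  The children sit at pairwise different heights, within a height range so
  small compared with their radius \<open>r'\<close> that a line of bounded slope is displaced by at most
  \<open>r' / 4\<close> over it; being very flat, they are nevertheless disjoint.\<close>

lemma blocking_children:
  fixes u :: "'a::euclidean_space"
  assumes u: "norm u = 1" and "0 < L" "0 < r" "0 < h" "0 < \<delta>"
  obtains Q r' h' where "finite Q" "0 < r'" "r' \<le> \<delta>" "0 < h'"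
    "\<And>c q x. q \<in> Q \<Longrightarrow> x \<in> cell u (c + q) (2 * r') (2 * h') \<Longrightarrow> dist c x < r \<and> \<bar>u \<bullet> (x - c)\<bar> < h"
    "\<And>c q q'. q \<in> Q \<Longrightarrow> q' \<in> Q \<Longrightarrow> q \<noteq> q' \<Longrightarrow>
       cell u (c + q) (2 * r') (2 * h') \<inter> cell u (c + q') (2 * r') (2 * h') = {}"
    "\<And>c v y. v \<bullet> u = 1 \<Longrightarrow> norm v \<le> L \<Longrightarrow> u \<bullet> (y - c) = 0 \<Longrightarrow> dist c y \<le> r / 2 \<Longrightarrow>
       \<exists>q\<in>Q. \<exists>t. u \<bullet> (y + t *\<^sub>R v - (c + q)) = 0 \<and> dist (c + q) (y + t *\<^sub>R v) \<le> r' / 2"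
proof -
  \<comment> \<open>A child's centre is within \<open>r / 2 + \<eta>\<close> of \<open>c\<close>,
    and its doubled radius is at most \<open>r / 4\<close>, so the doubled child fits into the
    parent.\<close>
  define r' where "r' = min \<delta> (r / 8)"
  \<comment> \<open>Upper bound for the heights of the children. Over such a height, a line of
    direction \<open>v\<close> drifts from the direction \<open>u\<close> by at most
    \<open>\<eta> * (L + 1) \<le> r' / 4\<close>.\<close>
  define \<eta> where "\<eta> = min (r' / (4 * (L + 1))) (h / 2)"
  have r': "0 < r'" "r' \<le> \<delta>" "r' \<le> r / 8"
    using assms by (auto simp: r'_def)
  have \<eta>: "0 < \<eta>" "\<eta> \<le> h / 2" "\<eta> * (L + 1) \<le> r' / 4"
  proof -
    show "0 < \<eta>"
      using assms r' by (simp add: \<eta>_def)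
    show "\<eta> \<le> h / 2"
      unfolding \<eta>_def by (rule min.cobounded2)
    have "\<eta> \<le> r' / (4 * (L + 1))"
      by (simp add: \<eta>_def)
    then show "\<eta> * (L + 1) \<le> r' / 4"
      using assms by (simp add: field_simps)
  qed
  have \<eta>r: "\<eta> \<le> r' / 4"
    using \<eta> \<open>0 < L\<close> by (smt (verit) mult_le_cancel_left1)
  \<comment> \<open>The core disc, moved to the origin. A finite net of mesh \<open>r' / 4\<close>
    in it gives the horizontal positions of the children.\<close>
  define D where "D = {y. u \<bullet> y = 0} \<inter> cball 0 (r / 2)"
  have "compact D"
    unfolding D_def by (intro closed_Int_compact closed_hyperplane compact_cball)
  then obtain N where N: "N \<subseteq> D" "finite N" "D \<subseteq> (\<Union>q\<in>N. ball q (r' / 4))"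
  proof (rule compactE_image)
    show "D \<subseteq> (\<Union>q\<in>D. ball q (r' / 4))"
      using r' by force
  qed auto
  obtain idx :: "'a \<Rightarrow> nat" where idx: "inj_on idx N" "\<And>q. q \<in> N \<Longrightarrow> idx q < card N"
  proof -
    obtain h where "bij_betw h N {0..<card N}"
      using ex_bij_betw_finite_nat [OF N(2)] by blast
    then show ?thesis
      by (intro that [of h]) (auto simp: bij_betw_def)
  qed
  define M where "M = real (card N) + 1"
  define ht where "ht q = \<eta> * (real (idx q) / M)" for q
  \<comment> \<open>Heights of different children differ by at least
    \<open>\<eta> / M = 8 * h'\<close>, whereas doubled children can only meet if their heights
    differ by at most \<open>4 * h'\<close>.\<close>
  define h' where "h' = \<eta> / (8 * M)"
  have M: "M \<ge> 1"
    by (simp add: M_def)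
  have h': "0 < h'" "h' \<le> h / 16"
  proof -
    show "0 < h'"
      using M \<eta> by (simp add: h'_def)
    have "\<eta> * 1 \<le> h / 2 * M"
      using M \<eta> \<open>0 < h\<close> by (intro mult_mono) auto
    then show "h' \<le> h / 16"
      using M by (simp add: h'_def field_simps)
  qed
  have ht: "0 \<le> ht q" "ht q \<le> \<eta>" if "q \<in> N" for q
  proof -
    have "real (idx q) / M \<le> 1"
      using idx(2) [OF that] by (simp add: M_def)
    then show "ht q \<le> \<eta>"
      unfolding ht_def using \<eta> mult_left_le by (metis less_eq_real_def)
    show "0 \<le> ht q"
      using M \<eta> by (simp add: ht_def)
  qed
  have sep: "4 * h' < \<bar>ht q - ht q'\<bar>" if "q \<in> N" "q' \<in> N" "q \<noteq> q'" for q q'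
  proof -
    have "idx q \<noteq> idx q'"
      using that idx(1) by (auto simp: inj_on_def)
    then have "1 \<le> \<bar>real (idx q) - real (idx q')\<bar>"
      by linarith
    then have "\<eta> / M * 1 \<le> \<eta> / M * \<bar>real (idx q) - real (idx q')\<bar>"
      using M \<eta> by (intro mult_left_mono) auto
    also have "\<dots> = \<bar>ht q - ht q'\<bar>"
    proof -
      have "ht q - ht q' = \<eta> / M * (real (idx q) - real (idx q'))"
        by (simp add: ht_def algebra_simps diff_divide_distrib)
      then show ?thesis
        using M \<eta> by (simp add: abs_mult)
    qed
    finally show ?thesis
      using M \<eta> by (simp add: h'_def field_simps)
  qed
  have uu: "u \<bullet> u = 1"
    using u by (simp add: norm_eq_1)
  define p where "p q = q + ht q *\<^sub>R u" for q
  have N_D: "u \<bullet> q = 0" "norm q \<le> r / 2" if "q \<in> N" for q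
    using that N(1) by (auto simp: D_def)
  have up: "u \<bullet> p q = ht q" if "q \<in> N" for q
    using N_D(1) [OF that] uu by (simp add: p_def inner_add_right)
  show ?thesis
  proof (rule that [of "p ` N" r' h'])
    show "finite (p ` N)" "0 < r'" "r' \<le> \<delta>" "0 < h'"
      using N r' h' by auto
  next
    fix c q' x assume "q' \<in> p ` N" and x: "x \<in> cell u (c + q') (2 * r') (2 * h')"
    then obtain q where q: "q \<in> N" "q' = p q" by auto
    have "norm (p q) \<le> r / 2 + \<eta>"
      unfolding p_def using norm_triangle_ineq [of q "ht q *\<^sub>R u"] u ht [OF q(1)] N_D [OF q(1)] by auto
    moreover have "dist c x \<le> norm (p q) + 2 * r'"
      using x q(2) dist_triangle [of c x "c + p q"] by (simp add: cell_def dist_norm)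
    ultimately have "dist c x < r"
      using \<eta>r r' by linarith
    moreover have "u \<bullet> (x - (c + p q)) = u \<bullet> (x - c) - ht q"
      using up [OF q(1)] by (simp add: inner_diff_right inner_add_right)
    then have "\<bar>u \<bullet> (x - c)\<bar> < h"
      using x q(2) ht [OF q(1)] \<eta> h' \<open>0 < h\<close> by (auto simp: cell_def)
    ultimately show "dist c x < r \<and> \<bar>u \<bullet> (x - c)\<bar> < h" ..
  next
    fix c q1' q2' assume "q1' \<in> p ` N" "q2' \<in> p ` N" "q1' \<noteq> q2'"
    then obtain q1 q2 where q: "q1 \<in> N" "q2 \<in> N" "q1' = p q1" "q2' = p q2" "q1 \<noteq> q2"
      by auto
    have "u \<bullet> (x - (c + p q)) = u \<bullet> (x - c) - ht q" if "q \<in> N" for q x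
      using up [OF that] by (simp add: inner_diff_right inner_add_right)
    then show "cell u (c + q1') (2 * r') (2 * h') \<inter> cell u (c + q2') (2 * r') (2 * h') = {}"
      using sep [OF q(1,2,5)] q by (fastforce simp: cell_def)
  next
    fix c v y assume v: "v \<bullet> u = 1" "norm v \<le> L" and y: "u \<bullet> (y - c) = 0" "dist c y \<le> r / 2"
    have "y - c \<in> D"
      using y by (simp add: D_def dist_norm norm_minus_commute)
    then obtain q where q: "q \<in> N" "dist q (y - c) < r' / 4"
      using N(3) by auto
    have "u \<bullet> (y + ht q *\<^sub>R v - (c + p q)) = u \<bullet> (y - c) + ht q * (v \<bullet> u) - u \<bullet> p q"
      by (simp add: inner_diff_right inner_add_right inner_commute)
    also have "\<dots> = 0"
      using y v up [OF q(1)] by simp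
    finally have 1: "u \<bullet> (y + ht q *\<^sub>R v - (c + p q)) = 0" .
    \<comment> \<open>Distance to the net point and drift of the line contribute
      \<open>r' / 4\<close> each, so the line crosses the core of the child.\<close>
    have "c + p q - (y + ht q *\<^sub>R v) = (q - (y - c)) + ht q *\<^sub>R (u - v)"
      by (simp add: p_def algebra_simps)
    then have "dist (c + p q) (y + ht q *\<^sub>R v) \<le> norm (q - (y - c)) + ht q * norm (u - v)"
      using norm_triangle_ineq [of "q - (y - c)" "ht q *\<^sub>R (u - v)"] ht [OF q(1)]
      unfolding dist_norm by (simp only: norm_scaleR abs_of_nonneg)
    also have "\<dots> \<le> r' / 4 + \<eta> * (L + 1)"
    proof (intro add_mono mult_mono)
      show "norm (u - v) \<le> L + 1"
        using norm_triangle_ineq4 [of u v] u v by simp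
    qed (use q ht [OF q(1)] \<eta> \<open>0 < L\<close> in \<open>auto simp: dist_norm\<close>)
    also have "\<dots> \<le> r' / 2"
      using \<eta> by simp
    finally show "\<exists>q\<in>p ` N. \<exists>t. u \<bullet> (y + t *\<^sub>R v - (c + q)) = 0 \<and> dist (c + q) (y + t *\<^sub>R v) \<le> r' / 2"
      using 1 q(1) by blast
  qed
qed

text \<open>Since \<open>\<phi> c\<close> is not isolated in \<open>K\<close>, the open image of the
  inner cell \<open>D\<close> contains as many points of \<open>K\<close> as there are children. A
  homeomorphism \<open>m\<close> supported in \<open>D\<close> moves the centres of the children to
  preimages of these points; before that, \<open>S\<close> shrinks the children so much that their
  final images are small.\<close>

lemma cells_into_perfect_set:
  fixes u :: "'a::euclidean_space" and \<phi> :: "'a \<Rightarrow> 'a"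
  assumes dim: "2 \<le> DIM('a)" and perfect: "\<And>z. z \<in> K \<Longrightarrow> z islimpt K"
    and \<phi>: "continuous_on UNIV \<phi>" "bij \<phi>" "\<phi> c \<in> K"
    and pos: "0 < r" "0 < h" "0 < \<delta>" "0 < r'" "0 < h'"
    and Q: "finite Q"
      "\<And>q x. q \<in> Q \<Longrightarrow> x \<in> cell u (c + q) (2 * r') (2 * h') \<Longrightarrow> dist c x < r \<and> \<bar>u \<bullet> (x - c)\<bar> < h"
      "\<And>q q'. q \<in> Q \<Longrightarrow> q' \<in> Q \<Longrightarrow> q \<noteq> q' \<Longrightarrow>
         cell u (c + q) (2 * r') (2 * h') \<inter> cell u (c + q') (2 * r') (2 * h') = {}"
  shows "\<exists>g. continuous_on UNIV g \<and> bij g \<and> (\<forall>x. x \<notin> cell u c r h \<longrightarrow> g x = x) \<and>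
    (\<forall>q\<in>Q. \<phi> (g (c + q)) \<in> K \<and> (\<forall>x\<in>cell u (c + q) r' h'. dist (\<phi> (g (c + q))) (\<phi> (g x)) \<le> \<delta>))"
proof -
  define D where "D = ball c r \<inter> {x. u \<bullet> x < u \<bullet> c + h} \<inter> {x. u \<bullet> x > u \<bullet> c - h}"
  have D_iff: "x \<in> D \<longleftrightarrow> dist c x < r \<and> \<bar>u \<bullet> (x - c)\<bar> < h" for x
    by (auto simp: D_def inner_diff_right)
  have D_cell: "D \<subseteq> cell u c r h"
    by (auto simp: D_iff cell_def)
  have opO: "open D"
    unfolding D_def by (intro open_Int open_ball open_halfspace_lt open_halfspace_gt)
  have conO: "connected D"
    unfolding D_def
    by (intro convex_connected convex_Int convex_ball convex_halfspace_lt convex_halfspace_gt)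
  have cO: "c \<in> D"
    using pos by (simp add: D_iff)
  have "open (\<phi> ` D)"
  proof (rule invariance_of_domain [OF _ opO])
    show "continuous_on D \<phi>"
      using \<phi>(1) by (rule continuous_on_subset) simp
    show "inj_on \<phi> D"
      using \<phi>(2) by (meson bij_is_inj inj_on_subset subset_UNIV)
  qed
  moreover have "\<phi> c islimpt K"
    using perfect \<phi>(3) .
  ultimately have "infinite (\<phi> ` D \<inter> K)"
    using cO by (auto simp: islimpt_eq_acc_point)
  then obtain Z where Z: "card Z = card Q" "Z \<subseteq> \<phi> ` D \<inter> K" "finite Z"
    using infinite_arbitrarily_large by metis
  then obtain z where z: "bij_betw z Q Z"
    using finite_same_card_bij Q(1) by metis
  have "\<exists>y. y \<in> D \<and> \<phi> y = z q" if "q \<in> Q" for q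
  proof -
    have "z q \<in> \<phi> ` D"
      using bij_betwE [OF z] Z(2) that by blast
    then show ?thesis
      by auto
  qed
  then obtain y where y: "\<And>q. q \<in> Q \<Longrightarrow> y q \<in> D" "\<And>q. q \<in> Q \<Longrightarrow> \<phi> (y q) = z q"
    by metis
  have zK: "z q \<in> K" if "q \<in> Q" for q
    using z Z that by (auto simp: bij_betw_def)
  have yinj: "y q \<noteq> y q'" if "q \<in> Q" "q' \<in> Q" "q \<noteq> q'" for q q'
    using z that y(2) by (metis bij_betw_def inj_onD)
  have child_D: "cell u (c + q) (2 * r') (2 * h') \<subseteq> D" if "q \<in> Q" for q
    using Q(2) [OF that] by (auto simp: D_iff)
  have qO: "c + q \<in> D" if "q \<in> Q" for q
    using child_D [OF that] pos by (auto simp: cell_def)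
  have aff: "affine hull D = UNIV"
    using affine_hull_open [OF opO] cO by auto
  \<comment> \<open>Moving finitely many points at once within a connected open set is where
    dimension at least 2 enters.\<close>
  obtain m m' where m: "homeomorphism UNIV UNIV m m'" "\<And>q. q \<in> Q \<Longrightarrow> m (c + q) = y q"
      "{x. \<not> (m x = x \<and> m' x = x)} \<subseteq> D"
  proof (rule homeomorphism_moving_points_exists [OF dim opO conO subset_UNIV Q(1),
        of "\<lambda>q. c + q" y])
    show "c + q \<in> D \<and> y q \<in> D" if "q \<in> Q" for q
      using qO y(1) that by simp
    show "pairwise (\<lambda>i j. c + i \<noteq> c + j \<and> y i \<noteq> y j) Q"
      using yinj by (auto simp: pairwise_def)
  qed (use conO aff in \<open>simp_all add: that\<close>)
  have m_bij: "bij m" and m_cont: "continuous_on UNIV m"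
    using m(1) by (auto simp: homeomorphism_def bij_def intro!: injI) metis+
  have m_id: "m x = x" if "x \<notin> D" for x
    using m(3) that by auto
  have \<phi>m: "continuous_on UNIV (\<lambda>x. \<phi> (m x))"
    using continuous_on_compose2 [OF \<phi>(1) m_cont] by simp
  \<comment> \<open>The shrinking radius comes from continuity of \<open>\<phi> \<circ> m\<close> at
    the centre, so it can be chosen only after \<open>m\<close>.\<close>
  have "\<exists>\<sigma>>0. \<forall>x. dist (c + q) x \<le> \<sigma> \<longrightarrow> dist (z q) (\<phi> (m x)) \<le> \<delta>" if q: "q \<in> Q" for q
  proof -
    obtain d where d: "d > 0" "\<And>x. dist x (c + q) < d \<Longrightarrow> dist (\<phi> (m x)) (\<phi> (m (c + q))) < \<delta>"
      using \<phi>m pos(3) unfolding continuous_on_iff by (metis UNIV_I)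
    have "dist (z q) (\<phi> (m x)) \<le> \<delta>" if "dist (c + q) x \<le> d / 2" for x
      using d(2) [of x] that d(1) m(2) [OF q] y(2) [OF q] by (simp add: dist_commute)
    then show ?thesis
      using d(1) by (intro exI [of _ "d / 2"]) auto
  qed
  then obtain \<sigma> where \<sigma>: "\<And>q. q \<in> Q \<Longrightarrow> 0 < \<sigma> q"
      "\<And>q x. q \<in> Q \<Longrightarrow> dist (c + q) x \<le> \<sigma> q \<Longrightarrow> dist (z q) (\<phi> (m x)) \<le> \<delta>"
    by metis
  have "\<forall>q\<in>Q. \<exists>s. continuous_on UNIV s \<and> bij s \<and> s (c + q) = c + q \<and>
      (\<forall>x. x \<notin> cell u (c + q) (2 * r') (2 * h') \<longrightarrow> s x = x) \<and>
      (\<forall>x. x \<in> cell u (c + q) r' h' \<longrightarrow> dist (c + q) (s x) \<le> \<sigma> q)"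
  proof
    fix q assume q: "q \<in> Q"
    obtain s where "continuous_on UNIV s" "bij s" "s (c + q) = c + q"
      "\<And>x. x \<notin> cell u (c + q) (2 * r') (2 * h') \<Longrightarrow> s x = x"
      "\<And>x. x \<in> cell u (c + q) r' h' \<Longrightarrow> dist (c + q) (s x) \<le> \<sigma> q"
      by (rule cell_radial_shrink [OF pos(4,5) \<sigma>(1) [OF q], where c = "c + q" and u = u]) (rule that)
    then show "\<exists>s. continuous_on UNIV s \<and> bij s \<and> s (c + q) = c + q \<and>
      (\<forall>x. x \<notin> cell u (c + q) (2 * r') (2 * h') \<longrightarrow> s x = x) \<and>
      (\<forall>x. x \<in> cell u (c + q) r' h' \<longrightarrow> dist (c + q) (s x) \<le> \<sigma> q)"
      by (intro exI [of _ s]) simp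
  qed
  from bchoice [OF this] obtain s where "\<forall>q\<in>Q. continuous_on UNIV (s q) \<and> bij (s q) \<and> s q (c + q) = c + q \<and>
      (\<forall>x. x \<notin> cell u (c + q) (2 * r') (2 * h') \<longrightarrow> s q x = x) \<and>
      (\<forall>x. x \<in> cell u (c + q) r' h' \<longrightarrow> dist (c + q) (s q x) \<le> \<sigma> q)" ..
  then have s: "\<And>q. q \<in> Q \<Longrightarrow> continuous_on UNIV (s q)" "\<And>q. q \<in> Q \<Longrightarrow> bij (s q)"
      "\<And>q. q \<in> Q \<Longrightarrow> s q (c + q) = c + q"
      "\<And>q x. q \<in> Q \<Longrightarrow> x \<notin> cell u (c + q) (2 * r') (2 * h') \<Longrightarrow> s q x = x"
      "\<And>q x. q \<in> Q \<Longrightarrow> x \<in> cell u (c + q) r' h' \<Longrightarrow> dist (c + q) (s q x) \<le> \<sigma> q"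
    by simp_all
  have "disjoint_family_on (\<lambda>q. cell u (c + q) (2 * r') (2 * h')) Q"
    using Q(3) by (simp add: disjoint_family_on_def)
  then have "\<exists>F. continuous_on UNIV F \<and> bij F \<and>
      (\<forall>q\<in>Q. \<forall>x\<in>cell u (c + q) (2 * r') (2 * h'). F x = s q x) \<and>
      (\<forall>x. x \<notin> (\<Union>q\<in>Q. cell u (c + q) (2 * r') (2 * h')) \<longrightarrow> F x = x)"
    using s by (intro glue_disjoint_supports [OF Q(1)]) auto
  then obtain S where S: "continuous_on UNIV S" "bij S"
      "\<And>q x. q \<in> Q \<Longrightarrow> x \<in> cell u (c + q) (2 * r') (2 * h') \<Longrightarrow> S x = s q x"
      "\<And>x. x \<notin> (\<Union>q\<in>Q. cell u (c + q) (2 * r') (2 * h')) \<Longrightarrow> S x = x"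
    by blast
  have sub: "cell u (c + q) r' h' \<subseteq> cell u (c + q) (2 * r') (2 * h')" for q
    using pos by (auto simp: cell_def)
  have Sc: "S (c + q) = c + q" if "q \<in> Q" for q
    using S(3) [OF that, of "c + q"] s(3) [OF that] pos by (simp add: cell_def)
  show ?thesis
  proof (intro exI [of _ "m \<circ> S"] conjI ballI allI impI)
    show "continuous_on UNIV (m \<circ> S)"
      using S(1) m_cont by (metis continuous_on_compose continuous_on_subset subset_UNIV)
    show "bij (m \<circ> S)"
      using S(2) m_bij by (rule bij_comp)
  next
    fix x assume "x \<notin> cell u c r h"
    then have "x \<notin> D"
      using D_cell by auto
    moreover from this have "S x = x"
      using child_D by (intro S(4)) auto
    ultimately show "(m \<circ> S) x = x"
      by (simp add: m_id)
  next
    fix q assume q: "q \<in> Q"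
    then show "\<phi> ((m \<circ> S) (c + q)) \<in> K"
      using Sc m(2) y(2) zK by simp
    fix x assume x: "x \<in> cell u (c + q) r' h'"
    then have "dist (c + q) (S x) \<le> \<sigma> q"
      using S(3) [OF q] s(5) [OF q x] subsetD [OF sub x] by simp
    then show "dist (\<phi> ((m \<circ> S) (c + q))) (\<phi> ((m \<circ> S) x)) \<le> \<delta>"
      using \<sigma>(2) [OF q] Sc [OF q] m(2) [OF q] y(2) [OF q] by simp
  qed
qed

section \<open>Iterating over all generations of cells\<close>

lemma nested_cells_limit:
  fixes f g :: "nat \<Rightarrow> 'a::euclidean_space \<Rightarrow> 'a" and C :: "nat \<Rightarrow> 'a set set"
  assumes cont: "\<And>k. continuous_on UNIV (f k)" and inj: "\<And>k. inj (f k)"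
    and step: "\<And>k. f (Suc k) = f k \<circ> g k"
    and g_id: "\<And>k x. x \<notin> \<Union>(C k) \<Longrightarrow> g k x = x"
    and g_inv: "\<And>k A x. A \<in> C k \<Longrightarrow> x \<in> A \<Longrightarrow> g k x \<in> A"
    and disj: "\<And>k A B. A \<in> C k \<Longrightarrow> B \<in> C k \<Longrightarrow> A \<noteq> B \<Longrightarrow> A \<inter> B = {}"
    and nest: "\<And>k B. B \<in> C (Suc k) \<Longrightarrow> \<exists>A\<in>C k. B \<subseteq> A"
    and cpt: "\<And>k A. A \<in> C k \<Longrightarrow> compact A"
    and small: "\<And>k A x y. A \<in> C k \<Longrightarrow> x \<in> A \<Longrightarrow> y \<in> A \<Longrightarrow> dist x y \<le> \<delta> k"
    and fsmall: "\<And>k A x y. A \<in> C k \<Longrightarrow> x \<in> A \<Longrightarrow> y \<in> A \<Longrightarrow> dist (f k x) (f k y) \<le> \<delta> k"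
    and \<delta>: "\<delta> \<longlonglongrightarrow> 0" "\<And>k. 0 \<le> \<delta> k"
  obtains F where "continuous_on UNIV F" "inj F" "\<And>k x. x \<notin> \<Union>(C k) \<Longrightarrow> F x = f k x"
    "\<And>k A. A \<in> C k \<Longrightarrow> F ` A \<subseteq> f k ` A"
proof -
  have nest_le: "\<exists>A\<in>C k. B \<subseteq> A" if "k \<le> j" "B \<in> C j" for j k B
    using that
  proof (induction j arbitrary: B rule: dec_induct)
    case base
    then show ?case by auto
  next
    case (step j)
    then show ?case
      using nest by (meson order_trans)
  qed
  have fA: "f j x \<in> f k ` A" if "k \<le> j" "A \<in> C k" "x \<in> A" for j k A x
    using that
  proof (induction j arbitrary: x rule: dec_induct)
    case base
    then show ?case by auto
  next
    case (step j)
    \<comment> \<open>A cell of stage \<open>j\<close> containing \<open>x\<close> lies in some cell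
      of stage \<open>k\<close>, which is \<open>A\<close> by disjointness; \<open>g j\<close> maps
      the smaller cell to itself.\<close>
    have "g j x \<in> A"
    proof (cases "x \<in> \<Union>(C j)")
      case True
      then obtain B where B: "B \<in> C j" "x \<in> B"
        by blast
      obtain A' where "A' \<in> C k" "B \<subseteq> A'"
        using nest_le [OF step.hyps(1) B(1)] by blast
      then have "B \<subseteq> A"
        using disj [of A k A'] B step.prems by auto
      then show ?thesis
        using g_inv B by blast
    next
      case False
      then show ?thesis
        using g_id step.prems by simp
    qed
    then show ?case
      using step.IH step.prems assms(3) by simp
  qed
  have f_out: "f j x = f k x" if "k \<le> j" "x \<notin> \<Union>(C k)" for j k x
    using that
  proof (induction j rule: dec_induct)
    case base
    then show ?case by auto
  next
    case (step j)
    have "x \<notin> \<Union>(C j)"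
      using nest_le [OF step.hyps(1)] step.prems by blast
    then show ?case
      using step.IH step.prems assms(3) g_id by simp
  qed
  have close: "dist (f j x) (f k x) \<le> \<delta> k" if kj: "k \<le> j" for j k x
  proof (cases "x \<in> \<Union>(C k)")
    case True
    then obtain A where A: "A \<in> C k" "x \<in> A"
      by blast
    then obtain y where "y \<in> A" "f j x = f k y"
      using fA [OF kj] by blast
    then show ?thesis
      using fsmall A by simp
  next
    case False
    then show ?thesis
      using f_out [OF kj] \<delta>(2) by simp
  qed
  have \<delta>_small: "\<exists>N. \<delta> N < e" if "e > 0" for e
    using order_tendstoD(2) [OF \<delta>(1) that] by (auto simp: eventually_sequentially)
  have "Cauchy (\<lambda>j. f j x)" for x
  proof (rule metric_CauchyI)
    fix e :: real assume "e > 0"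
    then obtain N where N: "\<delta> N < e / 2"
      using \<delta>_small [of "e / 2"] by auto
    have "dist (f i x) (f j x) < e" if "N \<le> i" "N \<le> j" for i j
      using close [OF that(1), of x] close [OF that(2), of x] N dist_triangle2 [of "f i x" "f j x" "f N x"]
      by linarith
    then show "\<exists>M. \<forall>m\<ge>M. \<forall>n\<ge>M. dist (f m x) (f n x) < e"
      by blast
  qed
  then have "\<forall>x. \<exists>l. (\<lambda>j. f j x) \<longlonglongrightarrow> l"
    by (simp add: Cauchy_convergent_iff convergent_def)
  then obtain F where F: "\<And>x. (\<lambda>j. f j x) \<longlonglongrightarrow> F x"
    by metis
  have F_close: "dist (F x) (f k x) \<le> \<delta> k" for k x
    by (rule tendsto_upperbound [OF tendsto_dist [OF F tendsto_const]])
      (use close in \<open>auto simp: eventually_sequentially\<close>)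
  have ulim: "uniform_limit UNIV f F sequentially"
    unfolding uniform_limit_iff
  proof (intro allI impI)
    fix e :: real assume "e > 0"
    show "\<forall>\<^sub>F n in sequentially. \<forall>x\<in>UNIV. dist (f n x) (F x) < e"
      using order_tendstoD(2) [OF \<delta>(1) \<open>e > 0\<close>]
      by (rule eventually_mono) (metis F_close dist_commute le_less_trans)
  qed
  have F_cont: "continuous_on UNIV F"
    by (rule uniform_limit_theorem [OF _ ulim]) (auto simp: cont)
  have F_out: "F x = f k x" if "x \<notin> \<Union>(C k)" for k x
  proof (rule LIMSEQ_unique [OF F])
    show "(\<lambda>j. f j x) \<longlonglongrightarrow> f k x"
      by (rule tendsto_eventually) (use f_out that in \<open>auto simp: eventually_sequentially\<close>)
  qed
  have F_in: "F x \<in> f k ` A" if "A \<in> C k" "x \<in> A" for k A x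
  proof (rule closed_sequentially)
    show "closed (f k ` A)"
      using cpt that cont by (intro compact_imp_closed compact_continuous_image) (auto intro: continuous_on_subset)
    show "f (j + k) x \<in> f k ` A" for j
      using fA that by simp
    show "(\<lambda>j. f (j + k) x) \<longlonglongrightarrow> F x"
      using F by (rule LIMSEQ_ignore_initial_segment)
  qed
  have "inj F"
  proof (rule injI, rule ccontr)
    fix x y assume eq: "F x = F y" and "x \<noteq> y"
    then obtain k where k: "\<delta> k < dist x y"
      using \<delta>_small [of "dist x y"] by auto
    have *: "F x \<noteq> F y" if A: "A \<in> C k" "x \<in> A" "y \<notin> A" for x y A
    proof -
      have "F y \<notin> f k ` A"
      proof (cases "y \<in> \<Union>(C k)")
        case True
        then obtain B where B: "B \<in> C k" "y \<in> B"
          by blast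
        then have "A \<inter> B = {}"
          using disj A by blast
        then have "f k ` A \<inter> f k ` B = {}"
          using inj [of k] by (auto simp: inj_def)
        then show ?thesis
          using F_in B by blast
      next
        case False
        then show ?thesis
          using F_out [OF False] A(3) inj [of k] by (auto simp: inj_def)
      qed
      then show ?thesis
        using F_in A by metis
    qed
    have "\<not> (A \<in> C k \<and> x \<in> A \<and> y \<in> A)" for A
      using small [of A k x y] k by force
    then have "x \<notin> \<Union>(C k)" "y \<notin> \<Union>(C k)"
      using * eq by (metis UnionE)+
    then have "f k x = f k y"
      using F_out eq by metis
    then show False
      using inj \<open>x \<noteq> y\<close> by (meson injD)
  qed
  with that F_cont F_out F_in show ?thesis
    by blast
qed

text \<open>One generation of the construction. The child pattern \<open>Q\<close> is independent of
  the centre, so all new cells share \<open>r'\<close> and \<open>h'\<close>; the maps found for the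
  single cells are glued. The last conclusion passes a line from a cell to one of its
  children.\<close>

lemma blocking_step:
  fixes u :: "'a::euclidean_space" and f :: "'a \<Rightarrow> 'a"
  assumes dim: "2 \<le> DIM('a)" and perfect: "\<And>z. z \<in> K \<Longrightarrow> z islimpt K"
    and u: "norm u = 1" and pos: "0 < L" "0 < r" "0 < h" "0 < \<delta>"
    and f: "continuous_on UNIV f" "bij f" "f ` S \<subseteq> K"
    and S: "finite S" "disjoint_family_on (\<lambda>c. cell u c r h) S"
  obtains g S' r' h' where "continuous_on UNIV g" "bij g"
    "\<And>x. x \<notin> (\<Union>c\<in>S. cell u c r h) \<Longrightarrow> g x = x"
    "\<And>c x. c \<in> S \<Longrightarrow> x \<in> cell u c r h \<Longrightarrow> g x \<in> cell u c r h"
    "finite S'" "0 < r'" "r' \<le> \<delta>" "0 < h'" "disjoint_family_on (\<lambda>c. cell u c r' h') S'"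
    "\<And>c'. c' \<in> S' \<Longrightarrow> \<exists>c\<in>S. cell u c' r' h' \<subseteq> cell u c r h"
    "f ` g ` S' \<subseteq> K"
    "\<And>c x. c \<in> S' \<Longrightarrow> x \<in> cell u c r' h' \<Longrightarrow> dist (f (g c)) (f (g x)) \<le> \<delta>"
    "\<And>c v y. c \<in> S \<Longrightarrow> v \<bullet> u = 1 \<Longrightarrow> norm v \<le> L \<Longrightarrow> u \<bullet> (y - c) = 0 \<Longrightarrow> dist c y \<le> r / 2 \<Longrightarrow>
       \<exists>c'\<in>S'. \<exists>t. u \<bullet> (y + t *\<^sub>R v - c') = 0 \<and> dist c' (y + t *\<^sub>R v) \<le> r' / 2"
proof -
  obtain Q r' h' where Q: "finite Q" "0 < r'" "r' \<le> \<delta>" "0 < h'"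
    and QD: "\<And>c q x. q \<in> Q \<Longrightarrow> x \<in> cell u (c + q) (2 * r') (2 * h') \<Longrightarrow> dist c x < r \<and> \<bar>u \<bullet> (x - c)\<bar> < h"
    and Qdisj: "\<And>c q q'. q \<in> Q \<Longrightarrow> q' \<in> Q \<Longrightarrow> q \<noteq> q' \<Longrightarrow>
       cell u (c + q) (2 * r') (2 * h') \<inter> cell u (c + q') (2 * r') (2 * h') = {}"
    and Qline: "\<And>c v y. v \<bullet> u = 1 \<Longrightarrow> norm v \<le> L \<Longrightarrow> u \<bullet> (y - c) = 0 \<Longrightarrow> dist c y \<le> r / 2 \<Longrightarrow>
       \<exists>q\<in>Q. \<exists>t. u \<bullet> (y + t *\<^sub>R v - (c + q)) = 0 \<and> dist (c + q) (y + t *\<^sub>R v) \<le> r' / 2"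
    by (rule blocking_children [OF u pos]) (rule that)
  have "\<exists>g. continuous_on UNIV g \<and> bij g \<and> (\<forall>x. x \<notin> cell u c r h \<longrightarrow> g x = x) \<and>
    (\<forall>q\<in>Q. f (g (c + q)) \<in> K \<and> (\<forall>x\<in>cell u (c + q) r' h'. dist (f (g (c + q))) (f (g x)) \<le> \<delta>))"
    if "c \<in> S" for c
    using that f(3)
    by (intro cells_into_perfect_set [OF dim perfect f(1,2) _ pos(2-4) Q(2,4,1) QD Qdisj]) auto
  then have "\<forall>c\<in>S. \<exists>g. continuous_on UNIV g \<and> bij g \<and> (\<forall>x. x \<notin> cell u c r h \<longrightarrow> g x = x) \<and>
    (\<forall>q\<in>Q. f (g (c + q)) \<in> K \<and> (\<forall>x\<in>cell u (c + q) r' h'. dist (f (g (c + q))) (f (g x)) \<le> \<delta>))"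
    by blast
  from bchoice [OF this] obtain G where
    "\<forall>c\<in>S. continuous_on UNIV (G c) \<and> bij (G c) \<and> (\<forall>x. x \<notin> cell u c r h \<longrightarrow> G c x = x) \<and>
    (\<forall>q\<in>Q. f (G c (c + q)) \<in> K \<and>
      (\<forall>x\<in>cell u (c + q) r' h'. dist (f (G c (c + q))) (f (G c x)) \<le> \<delta>))" ..
  then have G: "\<And>c. c \<in> S \<Longrightarrow> continuous_on UNIV (G c)" "\<And>c. c \<in> S \<Longrightarrow> bij (G c)"
      "\<And>c x. c \<in> S \<Longrightarrow> x \<notin> cell u c r h \<Longrightarrow> G c x = x"
      "\<And>c q. c \<in> S \<Longrightarrow> q \<in> Q \<Longrightarrow> f (G c (c + q)) \<in> K"
      "\<And>c q x. c \<in> S \<Longrightarrow> q \<in> Q \<Longrightarrow> x \<in> cell u (c + q) r' h' \<Longrightarrow> dist (f (G c (c + q))) (f (G c x)) \<le> \<delta>"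
    by simp_all
  have "\<exists>F. continuous_on UNIV F \<and> bij F \<and> (\<forall>c\<in>S. \<forall>x\<in>cell u c r h. F x = G c x) \<and>
             (\<forall>x. x \<notin> (\<Union>c\<in>S. cell u c r h) \<longrightarrow> F x = x)"
    using G by (intro glue_disjoint_supports [OF S(1) _ _ _ S(2)]) auto
  then obtain g where g: "continuous_on UNIV g" "bij g" "\<And>c x. c \<in> S \<Longrightarrow> x \<in> cell u c r h \<Longrightarrow> g x = G c x"
      "\<And>x. x \<notin> (\<Union>c\<in>S. cell u c r h) \<Longrightarrow> g x = x"
    by blast
  have child: "cell u (c + q) r' h' \<subseteq> cell u (c + q) (2 * r') (2 * h')" for c q
    using Q by (auto simp: cell_def)
  have child_sub: "cell u (c + q) r' h' \<subseteq> cell u c r h" if "q \<in> Q" for c q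
    using child [of c q] QD [OF that, of _ c] by (force simp: cell_def)
  have centre: "c + q \<in> cell u c r h" if "q \<in> Q" for c q
    using child_sub [OF that] centre_in_cell Q by blast
  define S' where "S' = (\<lambda>(c, q). c + q) ` (S \<times> Q)"
  have S'E: "\<exists>c q. c \<in> S \<and> q \<in> Q \<and> c' = c + q" if "c' \<in> S'" for c'
    using that by (auto simp: S'_def)
  show ?thesis
  proof (rule that [of g S' r' h'])
    show "g x \<in> cell u c r h" if "c \<in> S" "x \<in> cell u c r h" for c x
      using bij_supported_mem [OF G(2,3)] that g(3) by metis
    show "finite S'"
      using S(1) Q(1) by (simp add: S'_def)
    show "disjoint_family_on (\<lambda>c. cell u c r' h') S'"
      unfolding disjoint_family_on_def
    proof (intro ballI impI)
      fix a b assume "a \<in> S'" "b \<in> S'" "a \<noteq> b"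
      then obtain c q c' q' where *: "c \<in> S" "q \<in> Q" "a = c + q" "c' \<in> S" "q' \<in> Q" "b = c' + q'"
        using S'E by meson
      show "cell u a r' h' \<inter> cell u b r' h' = {}"
      proof (cases "c = c'")
        case True
        then have "q \<noteq> q'"
          using * \<open>a \<noteq> b\<close> by auto
        then show ?thesis
          using Qdisj [of q q' c] child [of c q] child [of c q'] * True by blast
      next
        case False
        then have "cell u c r h \<inter> cell u c' r h = {}"
          using S(2) * by (auto simp: disjoint_family_on_def)
        then show ?thesis
          using child_sub [of q c] child_sub [of q' c'] * by blast
      qed
    qed
    show "\<exists>c\<in>S. cell u c' r' h' \<subseteq> cell u c r h" if "c' \<in> S'" for c'
      using S'E [OF that] child_sub by blast
    show "f ` g ` S' \<subseteq> K"
    proof (clarify)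
      fix c' assume "c' \<in> S'"
      then obtain c q where "c \<in> S" "q \<in> Q" "c' = c + q"
        using S'E by blast
      then show "f (g c') \<in> K"
        using g(3) centre G(4) by simp
    qed
    show "dist (f (g c')) (f (g x)) \<le> \<delta>" if "c' \<in> S'" and x: "x \<in> cell u c' r' h'" for c' x
    proof -
      obtain c q where "c \<in> S" "q \<in> Q" "c' = c + q"
        using S'E \<open>c' \<in> S'\<close> by blast
      then show ?thesis
        using x g(3) centre G(5) child_sub [of q c] by (simp add: subset_iff)
    qed
    show "\<exists>c'\<in>S'. \<exists>t. u \<bullet> (y + t *\<^sub>R v - c') = 0 \<and> dist c' (y + t *\<^sub>R v) \<le> r' / 2"
      if "c \<in> S" and cvy: "v \<bullet> u = 1" "norm v \<le> L" "u \<bullet> (y - c) = 0" "dist c y \<le> r / 2" for c v y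
    proof -
      obtain q t where "q \<in> Q" "u \<bullet> (y + t *\<^sub>R v - (c + q)) = 0 \<and> dist (c + q) (y + t *\<^sub>R v) \<le> r' / 2"
        using Qline [OF cvy] by blast
      then show ?thesis
        using \<open>c \<in> S\<close> by (intro bexI [of _ "c + q"]) (auto simp: S'_def)
    qed
  qed (use Q g in auto)
qed

text \<open>Repeating the step gives nested families of cells with intersection \<open>X\<close>.
  Points of \<open>X\<close> go to \<open>K\<close> because at stage \<open>k\<close> their images
  are within \<open>R / 2 ^ k\<close> of images of centres, which lie in the closed set
  \<open>K\<close>. A line that meets a cell of every stage meets \<open>X\<close> by
  compactness.\<close>

lemma blocking_embedding:
  fixes u :: "'a::euclidean_space"
  assumes dim: "2 \<le> DIM('a)" and perfect: "\<And>z. z \<in> K \<Longrightarrow> z islimpt K" and "closed K"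
    and u: "norm u = 1" and pos: "0 < L" "0 < R" and "c0 \<in> K"
  obtains F X where "continuous_on UNIV F" "bij F" "\<And>x. x \<notin> cball c0 R \<Longrightarrow> F x = x"
    "F ` X \<subseteq> K" "X \<subseteq> cball c0 R"
    "\<And>v y. v \<bullet> u = 1 \<Longrightarrow> norm v \<le> L \<Longrightarrow> u \<bullet> (y - c0) = 0 \<Longrightarrow> dist c0 y \<le> R / 2 \<Longrightarrow>
       \<exists>t. y + t *\<^sub>R v \<in> X"
proof -
  \<comment> \<open>\<open>P\<close> is the invariant of a stage and \<open>T\<close> relates
    consecutive stages. Map, centres, radius and half-height are chosen together because each stage
    depends on all of them; the clause for \<open>k = 0\<close> fixes the initial cell.\<close>
  define P where "P k = (\<lambda>(f, S, r, h). finite S \<and> 0 < r \<and> r \<le> R / 2 ^ k \<and> 0 < h \<and>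
    continuous_on UNIV f \<and> bij f \<and> f ` S \<subseteq> K \<and> disjoint_family_on (\<lambda>c. cell u c r h) S \<and>
    (\<forall>c\<in>S. \<forall>x\<in>cell u c r h. dist (f c) (f x) \<le> R / 2 ^ k) \<and>
    (k = 0 \<longrightarrow> f = id \<and> S = {c0} \<and> r = R))" for k :: nat
  define T where "T = (\<lambda>(f :: 'a \<Rightarrow> 'a, S, r, h) (f' :: 'a \<Rightarrow> 'a, S', r' :: real, h' :: real). \<exists>g :: 'a \<Rightarrow> 'a. f' = f \<circ> g \<and>
    (\<forall>x. x \<notin> (\<Union>c\<in>S. cell u c r h) \<longrightarrow> g x = x) \<and>
    (\<forall>c\<in>S. \<forall>x\<in>cell u c r h. g x \<in> cell u c r h) \<and>
    (\<forall>c'\<in>S'. \<exists>c\<in>S. cell u c' r' h' \<subseteq> cell u c r h) \<and>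
    (\<forall>c\<in>S. \<forall>v y. v \<bullet> u = 1 \<longrightarrow> norm v \<le> L \<longrightarrow> u \<bullet> (y - c) = 0 \<longrightarrow> dist c y \<le> r / 2 \<longrightarrow>
       (\<exists>c'\<in>S'. \<exists>t. u \<bullet> (y + t *\<^sub>R v - c') = 0 \<and> dist c' (y + t *\<^sub>R v) \<le> r' / 2)))"
  have "\<exists>s. \<forall>k. P k (s k) \<and> T (s k) (s (Suc k))"
  proof (rule dependent_nat_choice)
    have "P 0 (id, {c0}, R, R)"
      using pos \<open>c0 \<in> K\<close> bij_id continuous_on_id
      by (auto simp: P_def cell_def disjoint_family_on_def id_def)
    then show "\<exists>s. P 0 s" ..
  next
    fix s k assume "P k s"
    moreover obtain f S r h where s: "s = (f, S, r, h)"
      by (cases s) auto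
    ultimately have p: "finite S" "0 < r" "0 < h" "continuous_on UNIV f" "bij f" "f ` S \<subseteq> K"
        "disjoint_family_on (\<lambda>c. cell u c r h) S"
      by (simp_all add: P_def)
    have d: "0 < R / 2 ^ Suc k"
      using pos by simp
    obtain g S' r' h' where n: "continuous_on UNIV g" "bij g"
      "\<And>x. x \<notin> (\<Union>c\<in>S. cell u c r h) \<Longrightarrow> g x = x"
      "\<And>c x. c \<in> S \<Longrightarrow> x \<in> cell u c r h \<Longrightarrow> g x \<in> cell u c r h"
      "finite S'" "0 < r'" "r' \<le> R / 2 ^ Suc k" "0 < h'" "disjoint_family_on (\<lambda>c. cell u c r' h') S'"
      "\<And>c'. c' \<in> S' \<Longrightarrow> \<exists>c\<in>S. cell u c' r' h' \<subseteq> cell u c r h"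
      "f ` g ` S' \<subseteq> K"
      "\<And>c x. c \<in> S' \<Longrightarrow> x \<in> cell u c r' h' \<Longrightarrow> dist (f (g c)) (f (g x)) \<le> R / 2 ^ Suc k"
      "\<And>c v y. c \<in> S \<Longrightarrow> v \<bullet> u = 1 \<Longrightarrow> norm v \<le> L \<Longrightarrow> u \<bullet> (y - c) = 0 \<Longrightarrow> dist c y \<le> r / 2 \<Longrightarrow>
       \<exists>c'\<in>S'. \<exists>t. u \<bullet> (y + t *\<^sub>R v - c') = 0 \<and> dist c' (y + t *\<^sub>R v) \<le> r' / 2"
      by (rule blocking_step [OF dim perfect u pos(1) p(2,3) d p(4-6,1,7)]) (assumption, rule that)
    have "continuous_on UNIV (f \<circ> g)"
      using p(4) n(1) by (metis continuous_on_compose continuous_on_subset subset_UNIV)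
    moreover have "bij (f \<circ> g)"
      using p(5) n(2) by (simp add: bij_comp)
    ultimately have "P (Suc k) (f \<circ> g, S', r', h')"
      unfolding P_def prod.case using n(5-9,11,12) by (simp add: image_comp)
    moreover have "T s (f \<circ> g, S', r', h')"
      unfolding T_def s prod.case
      by (rule exI [of _ g], intro conjI allI impI ballI refl; rule n(3,4,10,13); assumption)
    ultimately show "\<exists>s'. P (Suc k) s' \<and> T s s'"
      by blast
  qed
  then obtain s where s: "\<And>k. P k (s k)" "\<And>k. T (s k) (s (Suc k))"
    by blast
  define f S r h where "f k = fst (s k)" and "S k = fst (snd (s k))"
    and "r k = fst (snd (snd (s k)))" and "h k = snd (snd (snd (s k)))" for k
  have s_eq: "s k = (f k, S k, r k, h k)" for k
    by (simp add: f_def S_def r_def h_def)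
  have p: "finite (S k)" "0 < r k" "r k \<le> R / 2 ^ k" "0 < h k" "continuous_on UNIV (f k)"
      "bij (f k)" "f k ` S k \<subseteq> K" "disjoint_family_on (\<lambda>c. cell u c (r k) (h k)) (S k)"
      "\<And>c x. c \<in> S k \<Longrightarrow> x \<in> cell u c (r k) (h k) \<Longrightarrow> dist (f k c) (f k x) \<le> R / 2 ^ k" for k
    using s(1) [of k] by (simp_all add: s_eq P_def)
  have p0: "f 0 = id" "S 0 = {c0}" "r 0 = R"
    using s(1) [of 0] by (simp_all add: s_eq P_def)
  define C where "C k = (\<lambda>c. cell u c (r k) (h k)) ` S k" for k
  have "\<forall>k. \<exists>g. f (Suc k) = f k \<circ> g \<and> (\<forall>x. x \<notin> \<Union>(C k) \<longrightarrow> g x = x) \<and> (\<forall>A\<in>C k. \<forall>x\<in>A. g x \<in> A)"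
  proof
    fix k
    from s(2) [of k] obtain g where "f (Suc k) = f k \<circ> g"
        "\<forall>x. x \<notin> (\<Union>c\<in>S k. cell u c (r k) (h k)) \<longrightarrow> g x = x"
        "\<forall>c\<in>S k. \<forall>x\<in>cell u c (r k) (h k). g x \<in> cell u c (r k) (h k)"
      unfolding s_eq T_def prod.case by blast
    then show "\<exists>g. f (Suc k) = f k \<circ> g \<and> (\<forall>x. x \<notin> \<Union>(C k) \<longrightarrow> g x = x) \<and> (\<forall>A\<in>C k. \<forall>x\<in>A. g x \<in> A)"
      by (intro exI [of _ g]) (simp add: C_def)
  qed
  from choice [OF this] obtain g where "\<forall>k. f (Suc k) = f k \<circ> g k \<and>
    (\<forall>x. x \<notin> \<Union>(C k) \<longrightarrow> g k x = x) \<and> (\<forall>A\<in>C k. \<forall>x\<in>A. g k x \<in> A)" ..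
  then have g: "\<And>k. f (Suc k) = f k \<circ> g k" "\<And>k x. x \<notin> \<Union>(C k) \<Longrightarrow> g k x = x"
      "\<And>k A x. A \<in> C k \<Longrightarrow> x \<in> A \<Longrightarrow> g k x \<in> A"
    by simp_all
  have nest: "\<exists>A\<in>C k. B \<subseteq> A" if "B \<in> C (Suc k)" for k B
    using s(2) [of k] that by (fastforce simp: s_eq T_def C_def)
  have line: "\<exists>c'\<in>S (Suc k). \<exists>t. u \<bullet> (y + t *\<^sub>R v - c') = 0 \<and> dist c' (y + t *\<^sub>R v) \<le> r (Suc k) / 2"
    if "c \<in> S k" "v \<bullet> u = 1" "norm v \<le> L" "u \<bullet> (y - c) = 0" "dist c y \<le> r k / 2" for k c v y
  proof -
    have "\<forall>c\<in>S k. \<forall>v y. v \<bullet> u = 1 \<longrightarrow> norm v \<le> L \<longrightarrow> u \<bullet> (y - c) = 0 \<longrightarrow> dist c y \<le> r k / 2 \<longrightarrow>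
       (\<exists>c'\<in>S (Suc k). \<exists>t. u \<bullet> (y + t *\<^sub>R v - c') = 0 \<and> dist c' (y + t *\<^sub>R v) \<le> r (Suc k) / 2)"
      using s(2) [of k] unfolding s_eq T_def prod.case by blast
    then show ?thesis
      using that by blast
  qed
  have disj: "A \<inter> B = {}" if "A \<in> C k" "B \<in> C k" "A \<noteq> B" for k A B
  proof -
    obtain a b where "a \<in> S k" "b \<in> S k" "A = cell u a (r k) (h k)" "B = cell u b (r k) (h k)"
      using \<open>A \<in> C k\<close> \<open>B \<in> C k\<close> by (auto simp: C_def)
    then show ?thesis
      using p(8) [of k] \<open>A \<noteq> B\<close> unfolding disjoint_family_on_def by metis
  qed
  have cpt: "compact A" if "A \<in> C k" for k A
    using that by (auto simp: C_def compact_cell)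
  have small: "dist x y \<le> 2 * R / 2 ^ k" if "A \<in> C k" "x \<in> A" "y \<in> A" for k A x y
  proof -
    obtain c where "A = cell u c (r k) (h k)"
      using \<open>A \<in> C k\<close> by (auto simp: C_def)
    then have "dist c x \<le> r k" "dist c y \<le> r k"
      using that by (auto simp: cell_def)
    then show ?thesis
      using p(3) [of k] dist_triangle3 [of x y c] by simp
  qed
  have fsmall: "dist (f k x) (f k y) \<le> 2 * R / 2 ^ k" if "A \<in> C k" "x \<in> A" "y \<in> A" for k A x y
  proof -
    obtain c where "c \<in> S k" "A = cell u c (r k) (h k)"
      using \<open>A \<in> C k\<close> by (auto simp: C_def)
    then have "dist (f k c) (f k x) \<le> R / 2 ^ k" "dist (f k c) (f k y) \<le> R / 2 ^ k"
      using that p(9) by auto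
    then show ?thesis
      using dist_triangle3 [of "f k x" "f k y" "f k c"] by simp
  qed
  have lim: "(\<lambda>k. a / 2 ^ k) \<longlonglongrightarrow> 0" for a :: real
    using tendsto_mult [OF tendsto_const LIMSEQ_power_zero [of "1/2"], of a] by (simp add: power_divide)
  have inj: "inj (f k)" for k
    using p(6) by (rule bij_is_inj)
  have nonneg: "0 \<le> 2 * R / 2 ^ k" for k
    using pos by simp
  obtain F where F: "continuous_on UNIV F" "inj F" "\<And>k x. x \<notin> \<Union>(C k) \<Longrightarrow> F x = f k x"
    "\<And>k A. A \<in> C k \<Longrightarrow> F ` A \<subseteq> f k ` A"
    by (rule nested_cells_limit [OF p(5) inj g disj nest cpt small fsmall lim nonneg]) (assumption | rule that)+
  have C0: "C 0 = {cell u c0 R (h 0)}" "cell u c0 R (h 0) \<subseteq> cball c0 R"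
    by (auto simp: C_def p0 cell_def)
  have F_id: "F x = x" if "x \<notin> cball c0 R" for x
    using F(3) [of x 0] subsetD [OF C0(2), of x] that by (auto simp: p0 C0(1))
  \<comment> \<open>The limit is so far only injective; bounded displacement makes it
    surjective.\<close>
  have "dist (F x) x \<le> 2 * R" for x
  proof (cases "x \<in> cell u c0 R (h 0)")
    case True
    then have "F x \<in> cell u c0 R (h 0)"
      using F(4) [of "cell u c0 R (h 0)" 0] by (auto simp: p0 C0)
    then show ?thesis
      using True C0 small [of "cell u c0 R (h 0)" 0] by simp
  next
    case False
    then have "F x = x"
      using F(3) [of x 0] by (simp add: p0 C0)
    then show ?thesis
      using pos by simp
  qed
  then have F_bij: "bij F"
    by (rule continuous_inj_bounded_displacement_bij [OF F(1,2)])
  define X where "X = (\<Inter>k. \<Union>(C k))"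
  have FX: "F ` X \<subseteq> K"
  proof clarify
    fix x assume x: "x \<in> X"
    have "F x \<in> closure K"
      unfolding closure_approachable
    proof (intro allI impI)
      fix e :: real assume "e > 0"
      then obtain k where k: "R / 2 ^ k < e"
        using order_tendstoD(2) [OF lim [of R] \<open>e > 0\<close>] by (auto simp: eventually_sequentially)
      obtain c where c: "c \<in> S k" "x \<in> cell u c (r k) (h k)"
        using x by (auto simp: X_def C_def)
      then have "F x \<in> f k ` cell u c (r k) (h k)"
        using F(4) [of "cell u c (r k) (h k)" k] by (auto simp: C_def)
      then have "dist (f k c) (F x) \<le> R / 2 ^ k"
        using p(9) c(1) by auto
      then show "\<exists>y\<in>K. dist y (F x) < e"
        using p(7) [of k] c(1) k by (intro bexI [of _ "f k c"]) auto
    qed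
    then show "F x \<in> K"
      using \<open>closed K\<close> by simp
  qed
  have XR: "X \<subseteq> cball c0 R"
  proof -
    have "X \<subseteq> \<Union>(C 0)"
      by (auto simp: X_def)
    then show ?thesis
      using C0 by simp
  qed
  have "\<exists>t. y + t *\<^sub>R v \<in> X"
    if v: "v \<bullet> u = 1" "norm v \<le> L" and y: "u \<bullet> (y - c0) = 0" "dist c0 y \<le> R / 2" for v y
  proof -
    have meet: "\<exists>c\<in>S k. \<exists>t. u \<bullet> (y + t *\<^sub>R v - c) = 0 \<and> dist c (y + t *\<^sub>R v) \<le> r k / 2" for k
    proof (induction k)
      case 0
      then show ?case
        using y by (auto simp: p0 intro!: exI [of _ 0])
    next
      case (Suc k)
      then obtain c t where "c \<in> S k" "u \<bullet> (y + t *\<^sub>R v - c) = 0" "dist c (y + t *\<^sub>R v) \<le> r k / 2"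
        by blast
      from line [OF this(1) v this(2,3)] obtain c' t'
        where "c' \<in> S (Suc k)" "u \<bullet> (y + t *\<^sub>R v + t' *\<^sub>R v - c') = 0"
          "dist c' (y + t *\<^sub>R v + t' *\<^sub>R v) \<le> r (Suc k) / 2"
        by blast
      then show ?case
        by (intro bexI [of _ c'] exI [of _ "t + t'"]) (simp_all add: scaleR_add_left add.assoc)
    qed
    \<comment> \<open>The equation describes the line through \<open>y\<close> in direction
      \<open>v\<close>: as \<open>v \<bullet> u = 1\<close>, the number
      \<open>u \<bullet> (x - y)\<close> is the parameter of \<open>x\<close>. In this form the line
      is visibly closed, and \<open>E k\<close> is compact.\<close>
    define E where "E k = \<Union>(C k) \<inter> {x. x = y + (u \<bullet> (x - y)) *\<^sub>R v}" for k
    have "compact (\<Union>(C k))" for k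
      using cpt p(1) by (intro compact_Union) (auto simp: C_def)
    moreover have "closed {x. x = y + (u \<bullet> (x - y)) *\<^sub>R v}"
      by (intro closed_Collect_eq continuous_intros)
    ultimately have "compact (E k)" for k
      by (simp add: E_def compact_Int_closed)
    moreover have "E k \<noteq> {}" for k
    proof -
      obtain c t where c: "c \<in> S k" "u \<bullet> (y + t *\<^sub>R v - c) = 0" "dist c (y + t *\<^sub>R v) \<le> r k / 2"
        using meet by blast
      then have "y + t *\<^sub>R v \<in> cell u c (r k) (h k)"
        using p(2) [of k] p(4) [of k] by (simp add: cell_def)
      then show ?thesis
        using c(1) v(1) by (auto simp: E_def C_def inner_commute intro!: exI [of _ "y + t *\<^sub>R v"])
    qed
    moreover have "E n \<subseteq> E m" if "m \<le> n" for m n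
    proof (rule lift_Suc_antimono_le [OF _ that])
      show "E (Suc k) \<subseteq> E k" for k
        using nest by (fastforce simp: E_def)
    qed
    ultimately have "\<Inter>(range E) \<noteq> {}"
      by (rule compact_nest)
    then obtain x where "\<And>k. x \<in> E k"
      by auto
    then have "x \<in> X" "x = y + (u \<bullet> (x - y)) *\<^sub>R v"
      by (auto simp: E_def X_def)
    then show ?thesis
      by metis
  qed
  with that F(1) F_bij F_id FX XR show ?thesis
    by blast
qed

section \<open>From one coordinate direction to all directions\<close>

lemma finite_separated:
  fixes Z :: "'a::metric_space set"
  assumes "finite Z"
  obtains d where "0 < d" "\<And>x y. x \<in> Z \<Longrightarrow> y \<in> Z \<Longrightarrow> x \<noteq> y \<Longrightarrow> d \<le> dist x y"
proof -
  let ?D = "insert 1 ((\<lambda>(x, y). dist x y) ` {(x, y) \<in> Z \<times> Z. x \<noteq> y})"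
  have fin: "finite ?D"
    by (intro finite.insertI finite_imageI finite_subset [OF _ finite_cartesian_product [OF assms assms]]) auto
  show ?thesis
  proof (rule that [of "Min ?D"])
    show "0 < Min ?D"
      using fin by (subst Min_gr_iff) auto
    show "Min ?D \<le> dist x y" if "x \<in> Z" "y \<in> Z" "x \<noteq> y" for x y
      using fin that by (intro Min_le) (auto intro!: image_eqI [where x = "(x, y)"])
  qed
qed

text \<open>The norm is at most the sum of the absolute coordinates. Rescaled to have
  \<open>b\<close>-coordinate 1, \<open>v\<close> has norm at most \<open>DIM('a)\<close>, so the
  basis directions with the single bound \<open>L = DIM('a)\<close> account for all lines.\<close>

lemma exists_large_coordinate:
  fixes v :: "'a::euclidean_space"
  obtains b where "b \<in> Basis" "norm v \<le> real DIM('a) * \<bar>v \<bullet> b\<bar>"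
proof (rule ccontr)
  assume "\<not> thesis"
  then have less: "real DIM('a) * \<bar>v \<bullet> b\<bar> < norm v" if "b \<in> Basis" for b
    using that \<open>\<And>b. b \<in> Basis \<Longrightarrow> norm v \<le> real DIM('a) * \<bar>v \<bullet> b\<bar> \<Longrightarrow> thesis\<close> by force
  have "(\<Sum>b\<in>Basis. real DIM('a) * \<bar>v \<bullet> b\<bar>) < (\<Sum>b\<in>(Basis :: 'a set). norm v)"
    using less by (intro sum_strict_mono) auto
  also have "\<dots> = real DIM('a) * norm v"
    by simp
  also have "\<dots> \<le> real DIM('a) * (\<Sum>b\<in>Basis. \<bar>v \<bullet> b\<bar>)"
    by (intro mult_left_mono norm_le_l1) auto
  finally show False
    by (simp add: sum_distrib_left)
qed

text \<open>An infinite \<open>K\<close> has a point for each basis vector. Disjoint balls about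
  these points carry one blocking map each, and every direction is blocked in at least one of the
  balls.\<close>

lemma blocking_homeomorphism:
  fixes K :: "'a::euclidean_space set"
  assumes dim: "2 \<le> DIM('a)" and perfect: "\<And>z. z \<in> K \<Longrightarrow> z islimpt K" and "closed K" "K \<noteq> {}"
    and "0 < \<epsilon>"
  obtains F where "continuous_on UNIV F" "bij F" "\<And>x. dist (F x) x \<le> \<epsilon>"
    "\<And>v. v \<noteq> 0 \<Longrightarrow> \<exists>W. open W \<and> W \<noteq> {} \<and> (\<forall>x\<in>W. \<exists>t. F (x + t *\<^sub>R v) \<in> K)"
proof -
  obtain z where "z \<in> K"
    using \<open>K \<noteq> {}\<close> by blast
  then have "infinite K"
    using perfect islimpt_finite by blast
  then obtain Z where Z: "card Z = DIM('a)" "Z \<subseteq> K" "finite Z"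
    using infinite_arbitrarily_large by metis
  then obtain c where c: "bij_betw c (Basis :: 'a set) Z"
    using finite_same_card_bij finite_Basis by metis
  have cK: "c b \<in> K" if "b \<in> Basis" for b
    using bij_betwE [OF c] Z(2) that by blast
  obtain d where d: "0 < d" "\<And>x y. x \<in> Z \<Longrightarrow> y \<in> Z \<Longrightarrow> x \<noteq> y \<Longrightarrow> d \<le> dist x y"
    using finite_separated [OF Z(3)] by blast
  \<comment> \<open>The final map preserves each ball, so \<open>2 * R \<le> \<epsilon>\<close>
    bounds its displacement; \<open>d / 3\<close> makes the balls disjoint.\<close>
  define R where "R = min (\<epsilon> / 2) (d / 3)"
  have R: "0 < R" "2 * R \<le> \<epsilon>" "2 * R < d"
    using d(1) \<open>0 < \<epsilon>\<close> by (auto simp: R_def)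
  have disj: "disjoint_family_on (\<lambda>b. cball (c b) R) Basis"
    unfolding disjoint_family_on_def
  proof (intro ballI impI)
    fix a b :: 'a assume ab: "a \<in> Basis" "b \<in> Basis" "a \<noteq> b"
    then have "c a \<noteq> c b" "c a \<in> Z" "c b \<in> Z"
      using c by (auto simp: bij_betw_def inj_on_def)
    then have "2 * R < dist (c a) (c b)"
      using d(2) [of "c a" "c b"] R by linarith
    then show "cball (c a) R \<inter> cball (c b) R = {}"
      by (intro disjoint_cballI) simp
  qed
  \<comment> \<open>Map and set form a pair so that one use of choice selects both.\<close>
  have "\<forall>b\<in>Basis. \<exists>FX. continuous_on UNIV (fst FX) \<and> bij (fst FX) \<and>
      (\<forall>x. x \<notin> cball (c b) R \<longrightarrow> fst FX x = x) \<and> fst FX ` snd FX \<subseteq> K \<and> snd FX \<subseteq> cball (c b) R \<and>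
      (\<forall>v y. v \<bullet> b = 1 \<longrightarrow> norm v \<le> real DIM('a) \<longrightarrow> b \<bullet> (y - c b) = 0 \<longrightarrow> dist (c b) y \<le> R / 2 \<longrightarrow>
         (\<exists>t. y + t *\<^sub>R v \<in> snd FX))"
  proof
    fix b :: 'a assume b: "b \<in> Basis"
    have L: "0 < real DIM('a)"
      by simp
    obtain F X where "continuous_on UNIV F" "bij F" "\<And>x. x \<notin> cball (c b) R \<Longrightarrow> F x = x"
      "F ` X \<subseteq> K" "X \<subseteq> cball (c b) R"
      "\<And>v y. v \<bullet> b = 1 \<Longrightarrow> norm v \<le> real DIM('a) \<Longrightarrow> b \<bullet> (y - c b) = 0 \<Longrightarrow> dist (c b) y \<le> R / 2 \<Longrightarrow>
         \<exists>t. y + t *\<^sub>R v \<in> X"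
      by (rule blocking_embedding [OF dim perfect \<open>closed K\<close> norm_Basis [OF b] L R(1) cK [OF b]])
        (assumption | rule that)+
    then show "\<exists>FX. continuous_on UNIV (fst FX) \<and> bij (fst FX) \<and>
      (\<forall>x. x \<notin> cball (c b) R \<longrightarrow> fst FX x = x) \<and> fst FX ` snd FX \<subseteq> K \<and> snd FX \<subseteq> cball (c b) R \<and>
      (\<forall>v y. v \<bullet> b = 1 \<longrightarrow> norm v \<le> real DIM('a) \<longrightarrow> b \<bullet> (y - c b) = 0 \<longrightarrow> dist (c b) y \<le> R / 2 \<longrightarrow>
         (\<exists>t. y + t *\<^sub>R v \<in> snd FX))"
      by (intro exI [of _ "(F, X)"]) simp
  qed
  from bchoice [OF this] obtain FX where FX: "\<forall>b\<in>Basis. continuous_on UNIV (fst (FX b)) \<and> bij (fst (FX b)) \<and>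
      (\<forall>x. x \<notin> cball (c b) R \<longrightarrow> fst (FX b) x = x) \<and> fst (FX b) ` snd (FX b) \<subseteq> K \<and>
      snd (FX b) \<subseteq> cball (c b) R \<and>
      (\<forall>v y. v \<bullet> b = 1 \<longrightarrow> norm v \<le> real DIM('a) \<longrightarrow> b \<bullet> (y - c b) = 0 \<longrightarrow> dist (c b) y \<le> R / 2 \<longrightarrow>
         (\<exists>t. y + t *\<^sub>R v \<in> snd (FX b)))" ..
  define E X where "E b = fst (FX b)" and "X b = snd (FX b)" for b
  have E: "continuous_on UNIV (E b)" "bij (E b)" "\<And>x. x \<notin> cball (c b) R \<Longrightarrow> E b x = x"
      "E b ` X b \<subseteq> K" "X b \<subseteq> cball (c b) R"
      "\<And>v y. v \<bullet> b = 1 \<Longrightarrow> norm v \<le> real DIM('a) \<Longrightarrow> b \<bullet> (y - c b) = 0 \<Longrightarrow> dist (c b) y \<le> R / 2 \<Longrightarrow>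
         \<exists>t. y + t *\<^sub>R v \<in> X b" if "b \<in> Basis" for b
    using bspec [OF FX that] by (simp_all add: E_def X_def)
  have "\<exists>F. continuous_on UNIV F \<and> bij F \<and> (\<forall>b\<in>Basis. \<forall>x\<in>cball (c b) R. F x = E b x) \<and>
             (\<forall>x. x \<notin> (\<Union>b\<in>Basis. cball (c b) R) \<longrightarrow> F x = x)"
    using E(1-3) by (intro glue_disjoint_supports [OF finite_Basis _ _ _ disj]) auto
  then obtain F where F: "continuous_on UNIV F" "bij F"
      "\<And>b x. b \<in> Basis \<Longrightarrow> x \<in> cball (c b) R \<Longrightarrow> F x = E b x"
      "\<And>x. x \<notin> (\<Union>b\<in>Basis. cball (c b) R) \<Longrightarrow> F x = x"
    by blast
  have "dist (F x) x \<le> \<epsilon>" for x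
  proof (cases "x \<in> (\<Union>b\<in>Basis. cball (c b) R)")
    case True
    then obtain b where b: "b \<in> Basis" "x \<in> cball (c b) R"
      by blast
    then have "F x \<in> cball (c b) R"
      using bij_supported_mem [OF E(2,3)] F(3) by metis
    then show ?thesis
      using b(2) R(2) dist_triangle3 [of "F x" x "c b"] by simp
  next
    case False
    then show ?thesis
      using F(4) \<open>0 < \<epsilon>\<close> by simp
  qed
  moreover have "\<exists>W. open W \<and> W \<noteq> {} \<and> (\<forall>x\<in>W. \<exists>t. F (x + t *\<^sub>R v) \<in> K)" if "v \<noteq> 0" for v
  proof -
    obtain b where b: "b \<in> Basis" "norm v \<le> real DIM('a) * \<bar>v \<bullet> b\<bar>"
      using exists_large_coordinate .
    then have nz: "v \<bullet> b \<noteq> 0"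
      using \<open>v \<noteq> 0\<close> by auto
    define w where "w = v /\<^sub>R (v \<bullet> b)"
    have w: "w \<bullet> b = 1" "norm w \<le> real DIM('a)"
      using nz b(2) by (auto simp: w_def field_simps)
    \<comment> \<open>The points whose line in direction \<open>w\<close> crosses the hyperplane
      through \<open>c b\<close> orthogonal to \<open>b\<close> at a distance less than
      \<open>R / 2\<close> from \<open>c b\<close>.\<close>
    define W where "W = {x. dist (c b) (x + (b \<bullet> (c b - x)) *\<^sub>R w) < R / 2}"
    have "open W"
      unfolding W_def by (intro open_Collect_less continuous_intros)
    moreover have "c b \<in> W"
      using R by (simp add: W_def)
    moreover have "\<exists>t. F (x + t *\<^sub>R v) \<in> K" if "x \<in> W" for x
    proof -
      define s where "s = b \<bullet> (c b - x)"
      have "b \<bullet> (x + s *\<^sub>R w - c b) = 0"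
        using w(1) by (simp add: s_def inner_diff_right inner_add_right inner_commute)
      moreover have "dist (c b) (x + s *\<^sub>R w) \<le> R / 2"
        using that by (simp add: W_def s_def)
      ultimately obtain t where t: "x + s *\<^sub>R w + t *\<^sub>R w \<in> X b"
        using E(6) [OF b(1) w] by blast
      then have "F (x + s *\<^sub>R w + t *\<^sub>R w) \<in> K"
        using E(4,5) [OF b(1)] F(3) [OF b(1)] by (auto simp: image_subset_iff subset_iff)
      moreover have "x + s *\<^sub>R w + t *\<^sub>R w = x + ((s + t) / (v \<bullet> b)) *\<^sub>R v"
        by (simp add: w_def divide_inverse algebra_simps)
      ultimately show ?thesis
        by metis
    qed
    ultimately show ?thesis
      by blast
  qed
  ultimately show ?thesis
    using that F(1,2) by blast
qed

section \<open>Projections to planes\<close>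

lemma orthogonal_projection_spec:
  assumes "plane P"
  shows "orthogonal_projection P x \<in> P"
    and "z \<in> P \<Longrightarrow> (x - orthogonal_projection P x) \<bullet> (z - orthogonal_projection P x) = 0"
  using theI' [OF orthogonal_projection_exists_unique [OF assms, of x]]
  unfolding orthogonal_projection_def orthogonal_def by auto

lemma orthogonal_projection_eqI:
  assumes "plane P" "y \<in> P" "\<And>z. z \<in> P \<Longrightarrow> (x - y) \<bullet> (z - y) = 0"
  shows "orthogonal_projection P x = y"
  using the1_equality [OF orthogonal_projection_exists_unique [OF assms(1), of x]] assms
  unfolding orthogonal_projection_def orthogonal_def by blast

text \<open>Projection does not increase distances: the orthogonality relations turn the squared
  distance of the projections into an inner product with \<open>x - y\<close>, to which
  Cauchy-Schwarz applies.\<close>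

lemma continuous_on_orthogonal_projection:
  assumes "plane P"
  shows "continuous_on S (orthogonal_projection P)"
proof -
  let ?p = "orthogonal_projection P"
  have "dist (?p x) (?p y) \<le> dist x y" for x y
  proof -
    have "(x - ?p x) \<bullet> (?p y - ?p x) = 0" "(y - ?p y) \<bullet> (?p x - ?p y) = 0"
      using orthogonal_projection_spec [OF assms] by blast+
    then have "(?p x - ?p y) \<bullet> (?p x - ?p y) = (x - y) \<bullet> (?p x - ?p y)"
      by (simp add: inner_diff_left inner_diff_right inner_commute)
    also have "\<dots> \<le> norm (x - y) * norm (?p x - ?p y)"
      by (rule norm_cauchy_schwarz)
    finally have "norm (?p x - ?p y) * norm (?p x - ?p y) \<le> norm (x - y) * norm (?p x - ?p y)"
      by (simp add: dot_square_norm power2_eq_square)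
    then show ?thesis
      by (cases "?p x = ?p y") (simp_all add: dist_norm)
  qed
  then show ?thesis
    unfolding continuous_on_iff by (meson le_less_trans)
qed

text \<open>Provides a direction along which the projection to \<open>P\<close> is constant: the
  direction space of \<open>P\<close> is a proper subspace, hence lies in a hyperplane through
  0.\<close>

lemma proper_plane_normal:
  fixes P :: "'a::euclidean_space set"
  assumes "plane P" "P \<noteq> UNIV"
  obtains v where "v \<noteq> 0" "\<And>y z. y \<in> P \<Longrightarrow> z \<in> P \<Longrightarrow> v \<bullet> (z - y) = 0"
proof -
  obtain a where a: "a \<in> P" and aff: "affine P"
    using assms(1) by (auto simp: plane_def)
  let ?S = "(\<lambda>x. - a + x) ` P"
  have sub: "subspace ?S"
    using affine_diffs_subspace [OF aff a] by simp
  have "?S \<noteq> UNIV"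
  proof
    assume S: "?S = UNIV"
    have "x \<in> P" for x
    proof -
      have "- a + x \<in> ?S"
        using S by simp
      then show ?thesis
        by auto
    qed
    then show False
      using assms(2) by auto
  qed
  then have "span ?S \<noteq> UNIV"
    using span_eq_iff sub by blast
  from span_not_univ_subset_hyperplane [OF this]
  obtain v where "v \<noteq> 0" "span ?S \<subseteq> {x. v \<bullet> x = 0}"
    by blast
  then have v: "v \<noteq> 0" "\<And>x. x \<in> ?S \<Longrightarrow> v \<bullet> x = 0"
    using span_base [of _ ?S] by (simp, blast)
  have "v \<bullet> (z - y) = 0" if "y \<in> P" "z \<in> P" for y z
    using v(2) [of "- a + y"] v(2) [of "- a + z"] that by (simp add: inner_add_right inner_diff_right)
  then show ?thesis
    using that v(1) by blast
qed

theorem mainTheorem6: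
  fixes K :: "(real ^ 'n::finite) set"
  assumes "CARD('n) \<ge> 2"
    and "is_cantor_set K"
  shows "\<forall>\<epsilon>>0. \<exists>h. eps_isotopy \<epsilon> h \<and>
           (\<forall>P. plane P \<and> P \<subset> UNIV \<longrightarrow>
              covering_dim (top_of_set (orthogonal_projection P ` (h 1 ` K)))
                = covering_dim (top_of_set P))"
proof (intro allI impI)
  fix \<epsilon> :: real assume "0 < \<epsilon>"
  have "compact K" "K \<noteq> {}"
    using assms(2) compact_cantor_set cantor_set_nonempty by blast+
  have dim: "2 \<le> DIM(real ^ 'n)"
    using assms(1) by simp
  obtain F :: "real ^ 'n \<Rightarrow> real ^ 'n" where F: "continuous_on UNIV F" "bij F" "\<And>x. dist (F x) x \<le> \<epsilon>"
    and block: "\<And>v. v \<noteq> 0 \<Longrightarrow> \<exists>W. open W \<and> W \<noteq> {} \<and> (\<forall>x\<in>W. \<exists>t. F (x + t *\<^sub>R v) \<in> K)"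
    by (rule blocking_homeomorphism [OF dim cantor_set_islimpt [OF assms(2)]
          compact_imp_closed [OF \<open>compact K\<close>] \<open>K \<noteq> {}\<close> \<open>0 < \<epsilon>\<close>])
      (assumption | rule that)+
  obtain g where "homeomorphism UNIV (range F) F g"
    by (rule invariance_of_domain_homeomorphism [OF open_UNIV F(1) order_refl bij_is_inj [OF F(2)]])
  then have hom: "homeomorphism UNIV UNIV g F"
    using F(2) by (subst homeomorphism_sym) (simp add: bij_def)
  have gF: "g (F x) = x" "F (g x) = x" for x
    using hom by (auto simp: homeomorphism_def)
  have "dist (g x) x \<le> \<epsilon>" for x
    using F(3) [of "g x"] gF by (simp add: dist_commute)
  from eps_isotopy_of_bounded_homeomorphism [OF hom this]
  obtain h where h: "eps_isotopy \<epsilon> h" "h 1 = g"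
    by blast
  have "covering_dim (top_of_set (orthogonal_projection P ` (g ` K))) = covering_dim (top_of_set P)"
    if P: "plane P" "P \<subset> UNIV" for P
  proof -
    let ?p = "orthogonal_projection P" and ?A = "orthogonal_projection P ` (g ` K)"
    have aff: "affine P"
      using P(1) by (simp add: plane_def)
    obtain v where v: "v \<noteq> 0" "\<And>y z. y \<in> P \<Longrightarrow> z \<in> P \<Longrightarrow> v \<bullet> (z - y) = 0"
      using proper_plane_normal [of P] P by blast
    obtain W w where W: "open W" "w \<in> W" "\<And>x. x \<in> W \<Longrightarrow> \<exists>t. F (x + t *\<^sub>R v) \<in> K"
      using block [OF v(1)] by blast
    obtain r where r: "0 < r" "cball w r \<subseteq> W"
      using W(1,2) open_contains_cball by blast
    have "y \<in> ?A" if y: "y \<in> P" "dist (?p w) y \<le> r" for y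
    proof -
      \<comment> \<open>The point \<open>w\<close> is translated parallel to \<open>P\<close> until
        it lies over \<open>y\<close>. Then \<open>x + t *\<^sub>R v - y\<close> is the sum of
        \<open>w - ?p w\<close> and a multiple of \<open>v\<close>, both normal to \<open>P\<close>,
        so the whole line projects to \<open>y\<close>.\<close>
      define x where "x = w + (y - ?p w)"
      have "x \<in> W"
        using r(2) y(2) by (auto simp: x_def dist_norm norm_minus_commute)
      then obtain t where t: "F (x + t *\<^sub>R v) \<in> K"
        using W(3) by blast
      have "?p (x + t *\<^sub>R v) = y"
      proof (rule orthogonal_projection_eqI [OF P(1) y(1)])
        fix z assume z: "z \<in> P"
        have "(x + t *\<^sub>R v - y) \<bullet> (z - y) = (w - ?p w) \<bullet> ((z - ?p w) - (y - ?p w)) + t * (v \<bullet> (z - y))"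
          by (simp add: x_def inner_add_left inner_diff_left)
        also have "\<dots> = 0"
          unfolding inner_diff_right [of "w - ?p w" "z - ?p w"]
          using orthogonal_projection_spec(2) [OF P(1)] v(2) [OF y(1) z] y(1) z by simp
        finally show "(x + t *\<^sub>R v - y) \<bullet> (z - y) = 0" .
      qed
      moreover have "x + t *\<^sub>R v \<in> g ` K"
        using t gF(1) by (metis image_eqI)
      ultimately show ?thesis
        by blast
    qed
    then have "P \<inter> cball (?p w) r \<subseteq> ?A"
      by auto
    moreover have "closed ?A"
      using hom \<open>compact K\<close> continuous_on_orthogonal_projection [OF P(1)]
      by (intro compact_imp_closed compact_continuous_image)
        (auto simp: homeomorphism_def intro: continuous_on_subset)
    moreover have "?A \<subseteq> P"
      using orthogonal_projection_spec(1) [OF P(1)] by blast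
    ultimately show ?thesis
      using covering_dim_eq_affine [OF aff orthogonal_projection_spec(1) [OF P(1)] r(1)] by blast
  qed
  then show "\<exists>h. eps_isotopy \<epsilon> h \<and>
           (\<forall>P. plane P \<and> P \<subset> UNIV \<longrightarrow>
              covering_dim (top_of_set (orthogonal_projection P ` (h 1 ` K)))
                = covering_dim (top_of_set P))"
    using h by (intro exI [of _ h]) simp
qed

end
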